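(* Let $n,d$ be positive integers. There exist a constant $s=s(d)$, a finite field $\mathbb{F}_q$ and a set of $n$ points $\mathcal{P}\subseteq\mathbb{F}_q^d$ such that the unit distance graph on $\mathcal{P}$ does not contain $K_{s,s}$ and $\mathcal{P}$ spans $\Omega_d\big(n^{2-\frac{1}{\lceil d/2\rceil+1}}\big)$ unit distances.
   Context: Two points $a,b\in\mathbb{F}_q^d$ are at unit distance if $(a_1-b_1)^2+\dots+(a_d-b_d)^2=1$. The unit distance graph of $\mathcal{P}$ has vertex set $\mathcal{P}$ and as edges the pairs of points at unit distance; the number of unit distances spanned by $\mathcal{P}$ is its number of edges. $K_{s,s}$ is the complete bipartite graph with vertex classes of size $s$, and not containing it means not containing it as a (not necessarily induced) subgraph. The constant $s$ depends only on $d$, and the constant implied by $\Omega_d$ is positive and depends only on $d$.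
   Formalization: The dimension is taken to be d ≥ 2, since for d = 1 any n points span at most n unit distances, fewer than order n^{3/2}; the lower bound on unit distances is claimed only for n ≥ 2, since a single point spans none. *)

theory Defs
  imports Complex_Main "HOL-Algebra.Ring" "HOL-Library.FuncSet"
begin

text \<open>The points of \<open>F\<^sup>d\<close> are the extensional functions on \<open>{1..d}\<close>, so that distinct functions are
  distinct points and cardinalities of point sets are the intended ones.\<close>

definition affine_space :: "('a, 'm) ring_scheme \<Rightarrow> nat \<Rightarrow> (nat \<Rightarrow> 'a) set" where
  "affine_space F d = {1..d} \<rightarrow>\<^sub>E carrier F"

definition unit_distance :: "('a, 'm) ring_scheme \<Rightarrow> nat \<Rightarrow> (nat \<Rightarrow> 'a) \<Rightarrow> (nat \<Rightarrow> 'a) \<Rightarrow> bool" where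
  "unit_distance F d a b \<longleftrightarrow>
     (\<Oplus>\<^bsub>F\<^esub>i\<in>{1..d}. (a i \<ominus>\<^bsub>F\<^esub> b i) [^]\<^bsub>F\<^esub> (2::nat)) = \<one>\<^bsub>F\<^esub>"

text \<open>Edges are unordered pairs. Over a field no loops arise, since a point has squared distance
  \<open>0 \<noteq> 1\<close> from itself.\<close>

definition unit_distance_edges ::
    "('a, 'm) ring_scheme \<Rightarrow> nat \<Rightarrow> (nat \<Rightarrow> 'a) set \<Rightarrow> (nat \<Rightarrow> 'a) set set" where
  "unit_distance_edges F d P = {{a, b} | a b. a \<in> P \<and> b \<in> P \<and> unit_distance F d a b}"

text \<open>\<open>K\<^bsub>s,s\<^esub>\<close> as a not necessarily induced subgraph of the graph with vertex set \<open>V\<close> and edge set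
  \<open>E\<close>. For \<open>s = 0\<close> this holds trivially, so a graph without \<open>K\<^bsub>s,s\<^esub>\<close> has \<open>s \<ge> 1\<close>.\<close>

definition contains_Kss :: "'v set \<Rightarrow> 'v set set \<Rightarrow> nat \<Rightarrow> bool" where
  "contains_Kss V E s \<longleftrightarrow>
     (\<exists>A B. A \<subseteq> V \<and> B \<subseteq> V \<and> finite A \<and> finite B \<and> A \<inter> B = {} \<and> card A = s \<and> card B = s \<and>
            (\<forall>a\<in>A. \<forall>b\<in>B. {a, b} \<in> E))"

text \<open>Conventions of the statement. Types cannot be quantified existentially, so the finite
  field is a ring structure whose carrier is a set of integers; every finite field has an
  isomorphic copy of this kind. A single point spans no unit distance, so a lower bound
  \<open>c n\<^sup>\<alpha>\<close> with \<open>c > 0\<close> can only be required for \<open>n \<ge> 2\<close>. Dimension \<open>d = 1\<close> has to be excluded: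
  there \<open>(a - b)\<^sup>2 = 1\<close> forces \<open>a - b\<close> to be \<open>1\<close> or \<open>-1\<close>, so \<open>n\<close> points span at most \<open>n\<close> unit
  distances, whereas the bound would be of order \<open>n\<close> to the power \<open>3/2\<close>.\<close>

end

theory Submission
  imports Defs "HOL-Algebra.Algebraic_Closure_Type" "HOL-Library.Function_Algebras"
begin

text \<open>Write \<open>d = 2 m + \<epsilon>\<close> with \<open>\<epsilon> \<in> {0, 1}\<close> and let \<open>S\<close> be the field with \<open>q = 3\<^sup>r\<close> elements. Over the
  quadratic extension of \<open>S\<close> the sum of \<open>d\<close> squares is equivalent to \<open>Q / \<nu>\<close>, where \<open>Q\<close> is an orthogonal
  sum of \<open>m\<close> hyperbolic planes and, for odd \<open>d\<close>, one square, and \<open>\<nu>\<close> is a nonsquare of \<open>S\<close>. So it is enough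
  to find points in \<open>S\<^sup>d\<close> for the distance \<open>Q (a - b) = \<nu>\<close>. The choice of \<open>\<nu>\<close> makes the form
  \<open>Q - \<nu> t\<^sup>2\<close> have Witt index \<open>m\<close>, so that no flat of dimension \<open>m\<close> lies on a sphere. This fails for the
  sum of squares over \<open>S\<close> itself when \<open>d = 5\<close>, say, which is why the points live in a subfield.

  The points are two fibres of the additive map with components
  \<open>\<Sum>\<^sub>i \<alpha>\<^sub>i\<^sup>t x\<^sub>i\<^bsup>3^(d - i)\<^esup>\<close>, \<open>t < m - 1\<close>, chosen such that the number of pairs at distance \<open>\<nu>\<close> is at
  least average. These are about \<open>q\<^bsup>d - m + 1\<^esup>\<close> points with about a \<open>1 / q\<close> fraction of pairs at distance
  \<open>\<nu>\<close>. If all points of \<open>A\<close> have distance \<open>\<nu>\<close> from all points of \<open>B\<close>, then the differences in \<open>A\<close> and those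
  in \<open>B\<close> lie in orthogonal subspaces, so that one of the two sets is contained in a flat of dimension at
  most \<open>m\<close> and on a sphere. As in the subspace-evasive sets of Dvir and Lovett, the exponents decrease along
  the coordinates, so that on such a flat every non-pivot coordinate contributes only terms of lower
  weight. The leading terms of the \<open>m - 1\<close> equations and of the sphere then bound the number of common
  solutions, by counting reduced monomials.\<close>

section \<open>Polynomial functions on a finite set\<close>

interpretation fun_space: vector_space "\<lambda>(c::'a::field) (f::'b \<Rightarrow> 'a) x. c * f x"
  by unfold_locales (auto simp: fun_eq_iff algebra_simps)

lemma sum_fun_apply: "(\<Sum>i\<in>I. F i) x = (\<Sum>i\<in>I. F i x)"
  by (induction I rule: infinite_finite_induct) auto

definition monom_fun :: "nat set \<Rightarrow> (nat \<Rightarrow> nat) \<Rightarrow> (nat \<Rightarrow> 'a::field) \<Rightarrow> 'a" where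
  "monom_fun J e y = (\<Prod>j\<in>J. y j ^ e j)"

lemma monom_fun_add: "monom_fun J (\<lambda>j. e j + e' j) y = monom_fun J e y * monom_fun J e' y"
  by (simp add: monom_fun_def power_add prod.distrib)

lemma monom_fun_zero [simp]: "monom_fun J (\<lambda>_. 0) y = 1"
  by (simp add: monom_fun_def)

lemma monom_fun_single:
  assumes "finite J" "l \<in> J"
  shows "monom_fun J (\<lambda>j. if j = l then k else 0) y = y l ^ k"
proof -
  have "monom_fun J (\<lambda>j. if j = l then k else 0) y = (\<Prod>j\<in>J. if j = l then y j ^ k else 1)"
    unfolding monom_fun_def by (intro prod.cong) auto
  then show ?thesis using assms by (simp add: prod.delta)
qed

locale polynomial_functions =
  fixes J :: "nat set" and Z :: "(nat \<Rightarrow> 'a::field) set" and w :: "nat \<Rightarrow> nat"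
  assumes finite_J [simp]: "finite J"
begin

definition weight :: "(nat \<Rightarrow> nat) \<Rightarrow> nat" where
  "weight e = (\<Sum>j\<in>J. w j * e j)"

text \<open>Polynomials are handled as functions modulo the vanishing ideal of \<open>Z\<close>:
  agreement with a combination of monomials is required on \<open>Z\<close> only. Equations that
  hold on \<open>Z\<close> thus become rewriting rules, and \<open>M\<close> records which exponents
  are allowed.\<close>

definition comb :: "(nat \<Rightarrow> nat) set \<Rightarrow> ((nat \<Rightarrow> 'a) \<Rightarrow> 'a) \<Rightarrow> bool" where
  "comb M F \<longleftrightarrow> (\<exists>G \<in> fun_space.span (monom_fun J ` M). \<forall>z\<in>Z. F z = G z)"

abbreviation below :: "nat \<Rightarrow> ((nat \<Rightarrow> 'a) \<Rightarrow> 'a) \<Rightarrow> bool" where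
  "below W \<equiv> comb {e. weight e < W}"

abbreviation upto_weight :: "nat \<Rightarrow> ((nat \<Rightarrow> 'a) \<Rightarrow> 'a) \<Rightarrow> bool" where
  "upto_weight W \<equiv> comb {e. weight e \<le> W}"

lemma weight_add: "weight (\<lambda>j. e j + e' j) = weight e + weight e'"
  by (simp add: weight_def algebra_simps sum.distrib)

lemma weight_zero [simp]: "weight (\<lambda>_. 0) = 0"
  by (simp add: weight_def)

lemma weight_single: "l \<in> J \<Longrightarrow> weight (\<lambda>j. if j = l then k else 0) = w l * k"
  by (simp add: weight_def if_distrib[of "\<lambda>x. _ * x"] sum.delta cong: if_cong)

lemma comb_cong: "comb M F \<Longrightarrow> (\<And>z. z \<in> Z \<Longrightarrow> F z = G z) \<Longrightarrow> comb M G"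
  by (auto simp: comb_def)

lemma comb_zero: "comb M (\<lambda>_. 0)"
  unfolding comb_def using fun_space.span_zero by (force simp: zero_fun_def)

lemma comb_add: "comb M F \<Longrightarrow> comb M G \<Longrightarrow> comb M (\<lambda>y. F y + G y)"
  unfolding comb_def
proof (elim bexE)
  fix A B assume "A \<in> fun_space.span (monom_fun J ` M)" "B \<in> fun_space.span (monom_fun J ` M)"
    "\<forall>z\<in>Z. F z = A z" "\<forall>z\<in>Z. G z = B z"
  then show "\<exists>G'\<in>fun_space.span (monom_fun J ` M). \<forall>z\<in>Z. F z + G z = G' z"
    by (intro bexI[of _ "A + B"]) (auto intro: fun_space.span_add)
qed

lemma comb_scale: "comb M F \<Longrightarrow> comb M (\<lambda>y. c * F y)"
  unfolding comb_def
proof (elim bexE)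
  fix A assume "A \<in> fun_space.span (monom_fun J ` M)" "\<forall>z\<in>Z. F z = A z"
  then show "\<exists>G'\<in>fun_space.span (monom_fun J ` M). \<forall>z\<in>Z. c * F z = G' z"
    by (intro bexI[of _ "\<lambda>y. c * A y"]) (auto intro: fun_space.span_scale)
qed

lemma comb_diff: "comb M F \<Longrightarrow> comb M G \<Longrightarrow> comb M (\<lambda>y. F y - G y)"
  using comb_add[of M F "\<lambda>y. (-1) * G y"] comb_scale[of M G "-1"] by simp

lemma comb_sum: "(\<And>i. i \<in> I \<Longrightarrow> comb M (F i)) \<Longrightarrow> comb M (\<lambda>y. \<Sum>i\<in>I. F i y)"
  by (induction I rule: infinite_finite_induct) (auto intro: comb_zero comb_add)

lemma comb_mono: "comb M F \<Longrightarrow> M \<subseteq> M' \<Longrightarrow> comb M' F"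
  unfolding comb_def using fun_space.span_mono[of "monom_fun J ` M" "monom_fun J ` M'"] by blast

lemma comb_monom: "e \<in> M \<Longrightarrow> comb M (monom_fun J e)"
  unfolding comb_def by (auto intro: fun_space.span_base)

lemma comb_induct:
  assumes "comb M F"
    and "\<And>e. e \<in> M \<Longrightarrow> P (monom_fun J e)"
    and "P (\<lambda>_. 0)"
    and "\<And>F G. P F \<Longrightarrow> P G \<Longrightarrow> P (\<lambda>y. F y + G y)"
    and "\<And>c F. P F \<Longrightarrow> P (\<lambda>y. c * F y)"
    and "\<And>F G. P F \<Longrightarrow> (\<And>z. z \<in> Z \<Longrightarrow> F z = G z) \<Longrightarrow> P G"
  shows "P F"
proof -
  obtain G where G: "G \<in> fun_space.span (monom_fun J ` M)" "\<forall>z\<in>Z. F z = G z"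
    using assms(1) by (auto simp: comb_def)
  have "P G"
    using G(1)
  proof (rule fun_space.span_induct)
    show "fun_space.subspace (Collect P)"
      using assms(3-5) by (auto simp: fun_space.subspace_def zero_fun_def plus_fun_def)
  qed (use assms(2) in auto)
  then show ?thesis using assms(6)[of G F] G(2) by simp
qed

lemma comb_trans:
  assumes "comb M F" "\<And>e. e \<in> M \<Longrightarrow> comb M' (monom_fun J e)"
  shows "comb M' F"
  using assms(1) by (rule comb_induct) (use assms(2) comb_zero comb_add comb_scale comb_cong in blast)+

lemma comb_mult:
  assumes F: "comb M F" and G: "comb M' G"
    and M'': "\<And>e e'. e \<in> M \<Longrightarrow> e' \<in> M' \<Longrightarrow> (\<lambda>j. e j + e' j) \<in> M''"
  shows "comb M'' (\<lambda>y. F y * G y)"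
  using F
proof (rule comb_induct[where P = "\<lambda>F. comb M'' (\<lambda>y. F y * G y)"])
  fix e assume e: "e \<in> M"
  show "comb M'' (\<lambda>y. monom_fun J e y * G y)"
    using G
  proof (rule comb_induct[where P = "\<lambda>G. comb M'' (\<lambda>y. monom_fun J e y * G y)"])
    show "comb M'' (\<lambda>y. monom_fun J e y * monom_fun J e' y)" if "e' \<in> M'" for e'
      using comb_monom[OF M''[OF e that]] by (rule comb_cong) (simp add: monom_fun_add)
    show "comb M'' (\<lambda>y. monom_fun J e y * (c * F y))"
      if "comb M'' (\<lambda>y. monom_fun J e y * F y)" for c F
      using comb_scale[OF that, of c] by (simp add: algebra_simps)
    show "comb M'' (\<lambda>y. monom_fun J e y * G y)"
      if "comb M'' (\<lambda>y. monom_fun J e y * F y)" "\<And>z. z \<in> Z \<Longrightarrow> F z = G z" for F G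
      using that(1) by (rule comb_cong) (simp add: that(2))
  qed (auto intro: comb_zero comb_add simp: distrib_left)
next
  show "comb M'' (\<lambda>y. c * F y * G y)" if "comb M'' (\<lambda>y. F y * G y)" for c F
    using comb_scale[OF that, of c] by (simp add: algebra_simps)
  show "comb M'' (\<lambda>y. F' y * G y)"
    if "comb M'' (\<lambda>y. F y * G y)" "\<And>z. z \<in> Z \<Longrightarrow> F z = F' z" for F F'
    using that(1) by (rule comb_cong) (simp add: that(2))
qed (auto intro: comb_zero comb_add simp: distrib_right)

lemma comb_const: "(\<lambda>_. 0) \<in> M \<Longrightarrow> comb M (\<lambda>_. c)"
  using comb_scale[OF comb_monom, of "\<lambda>_. 0" M c] by simp

lemma comb_power_var:
  assumes "l \<in> J" "(\<lambda>j. if j = l then k else 0) \<in> M"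
  shows "comb M (\<lambda>y. y l ^ k)"
  using comb_monom[OF assms(2)] by (rule comb_cong) (simp add: monom_fun_single assms(1))

text \<open>Lagrange interpolation: the indicator functions of the points of \<open>Z\<close> are
  polynomial, hence by \<open>all\<close> combinations of monomials from \<open>M\<close>. They are
  linearly independent, so the number of monomial functions bounds their number.\<close>

lemma card_le_card_monoms:
  assumes "finite Z" "finite (monom_fun J ` M :: ((nat \<Rightarrow> 'a) \<Rightarrow> 'a) set)"
    and sep: "\<And>z z'. z \<in> Z \<Longrightarrow> z' \<in> Z \<Longrightarrow> (\<And>j. j \<in> J \<Longrightarrow> z j = z' j) \<Longrightarrow> z = z'"
    and all: "\<And>e. comb M (monom_fun J e)"
  shows "card Z \<le> card (monom_fun J ` M :: ((nat \<Rightarrow> 'a) \<Rightarrow> 'a) set)"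
proof -
  have "\<exists>G \<in> fun_space.span (monom_fun J ` M). \<forall>z'\<in>Z. G z' = (if z' = z then 1 else 0)"
    if z: "z \<in> Z" for z
  proof -
    \<comment> \<open>For every other point a coordinate that tells it from \<open>z\<close>; the
      interpolation polynomial \<open>F\<close> has one linear factor per other point.\<close>
    have "\<exists>j. z' \<noteq> z \<and> z' \<in> Z \<longrightarrow> j \<in> J \<and> z' j \<noteq> z j" for z'
      using sep[OF _ z, of z'] by blast
    then obtain ix where ix: "\<And>z'. z' \<noteq> z \<Longrightarrow> z' \<in> Z \<Longrightarrow> ix z' \<in> J \<and> z' (ix z') \<noteq> z (ix z')"
      by metis
    define F where "F A y = (\<Prod>z'\<in>A. (y (ix z') - z' (ix z')) / (z (ix z') - z' (ix z')))" for A y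
    have "comb UNIV (F A)" if "A \<subseteq> Z - {z}" for A
    proof -
      have "finite A" using assms(1) that finite_subset by blast
      then show ?thesis using that
      proof (induction A rule: finite_induct)
        case empty
        then show ?case unfolding F_def by (simp add: comb_const)
      next
        case (insert a A)
        have 1: "ix a \<in> J" using ix[of a] insert by auto
        have "comb UNIV (\<lambda>y. y (ix a) ^ 1)"
          by (rule comb_power_var) (use 1 in auto)
        then have "comb UNIV (\<lambda>y. (y (ix a) - a (ix a)))"
          using comb_diff comb_const by simp
        from comb_scale[OF this, of "1 / (z (ix a) - a (ix a))"]
        have "comb UNIV (\<lambda>y. (1 / (z (ix a) - a (ix a))) * (y (ix a) - a (ix a)) * F A y)"
          by (rule comb_mult) (use insert in auto)
        then show ?case
          by (rule comb_cong) (use insert in \<open>simp add: F_def\<close>)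
      qed
    qed
    then have "comb UNIV (F (Z - {z}))" by simp
    then have "comb M (F (Z - {z}))" by (rule comb_trans) (use all in auto)
    moreover have "F (Z - {z}) z' = (if z' = z then 1 else 0)" if "z' \<in> Z" for z'
    proof (cases "z' = z")
      case True
      then show ?thesis unfolding F_def using ix by (simp, intro prod.neutral) force
    next
      case False
      then show ?thesis unfolding F_def using that assms(1) by auto
    qed
    ultimately show ?thesis unfolding comb_def by metis
  qed
  then obtain G where G: "\<And>z. z \<in> Z \<Longrightarrow> G z \<in> fun_space.span (monom_fun J ` M)"
    "\<And>z z'. z \<in> Z \<Longrightarrow> z' \<in> Z \<Longrightarrow> G z z' = (if z' = z then 1 else 0 :: 'a)"
    by metis
  have inj: "inj_on G Z"
  proof (rule inj_onI)
    fix a b assume "a \<in> Z" "b \<in> Z" "G a = G b"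
    then show "a = b" using G(2)[of a a] G(2)[of b a] by (auto split: if_splits)
  qed
  have key: "f x = 0"
    if sum0: "(\<Sum>x\<in>G ` Z. (\<lambda>y. f x * x y)) = 0" and x: "x \<in> G ` Z" for f x
  proof -
    obtain a where a: "a \<in> Z" "x = G a" using x by auto
    have "0 = (\<Sum>x\<in>G ` Z. (\<lambda>y. f x * x y)) a" using sum0 by simp
    also have "\<dots> = (\<Sum>z\<in>Z. f (G z) * G z a)"
      unfolding sum_fun_apply sum.reindex[OF inj] o_def ..
    also have "\<dots> = (\<Sum>z\<in>Z. if z = a then f (G z) else 0)"
      by (intro sum.cong) (auto simp: G(2) a)
    also have "\<dots> = f x" using a assms(1) by simp
    finally show "f x = 0" by simp
  qed
  have "fun_space.independent (G ` Z)"
    unfolding fun_space.dependent_finite[OF finite_imageI[OF assms(1)]]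
  proof (rule notI, elim exE conjE bexE)
    fix u v
    assume "v \<in> G ` Z" "u v \<noteq> 0" "(\<Sum>v\<in>G ` Z. (\<lambda>y. u v * v y)) = 0"
    then show False using key[of u v] by simp
  qed
  moreover have "G ` Z \<subseteq> fun_space.span (monom_fun J ` M)" using G(1) by blast
  ultimately have "card (G ` Z) \<le> card (monom_fun J ` M :: ((nat \<Rightarrow> 'a) \<Rightarrow> 'a) set)"
    using fun_space.independent_span_bound[OF assms(2)] by blast
  then show ?thesis using card_image[OF inj] by simp
qed

text \<open>By \<open>red\<close> every multiple of \<open>y l ^ E l\<close> can be rewritten into
  monomials of smaller weight. This process stops, so the monomials with all exponents below
  \<open>E\<close> span all polynomial functions on \<open>Z\<close>, and interpolation
  applies.\<close>

lemma footprint_bound: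
  assumes "finite Z"
    and sep: "\<And>z z'. z \<in> Z \<Longrightarrow> z' \<in> Z \<Longrightarrow> (\<And>j. j \<in> J \<Longrightarrow> z j = z' j) \<Longrightarrow> z = z'"
    and red: "\<And>l. l \<in> J \<Longrightarrow> below (w l * E l) (\<lambda>y. y l ^ E l)"
  shows "card Z \<le> (\<Prod>j\<in>J. E j)"
proof -
  define M where "M = {e. \<forall>j\<in>J. e j < E j}"
  have red': "comb M (monom_fun J e)" for e
  proof (induction "weight e" arbitrary: e rule: less_induct)
    case less
    show ?case
    proof (cases "e \<in> M")
      case True
      then show ?thesis by (rule comb_monom)
    next
      case False
      then obtain l where l: "l \<in> J" "E l \<le> e l" by (auto simp: M_def not_less)
      define e0 where "e0 = (\<lambda>j. if j = l then e j - E l else e j)"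
      define e1 where "e1 = (\<lambda>j. if j = l then E l else 0)"
      have e: "e = (\<lambda>j. e0 j + e1 j)" using l by (auto simp: e0_def e1_def)
      have w: "weight e = weight e0 + w l * E l"
        by (subst e, subst weight_add) (use l in \<open>simp add: e1_def weight_single\<close>)
      have "comb {e0} (monom_fun J e0)" by (rule comb_monom) simp
      from comb_mult[OF this red[OF l(1)], of "{e'. weight e' < weight e}"]
      have "below (weight e) (\<lambda>y. monom_fun J e0 y * y l ^ E l)"
        by (simp add: weight_add w)
      then have "below (weight e) (monom_fun J e)"
        by (rule comb_cong) (subst e, simp add: monom_fun_add e1_def monom_fun_single l)
      then show ?thesis by (rule comb_trans) (use less in auto)
    qed
  qed
  \<comment> \<open>\<open>M\<close> leaves the exponents off \<open>J\<close> free and so may be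
    infinite; the monomial functions depend only on the restriction to \<open>J\<close>.\<close>
  have "monom_fun J e \<in> monom_fun J ` (Pi\<^sub>E J (\<lambda>j. {..<E j}))" if "e \<in> M" for e
  proof (rule image_eqI[of _ _ "restrict e J"])
    show "monom_fun J e = monom_fun J (restrict e J)"
      by (auto simp: monom_fun_def fun_eq_iff)
  qed (use that in \<open>auto simp: M_def\<close>)
  then have sub: "monom_fun J ` M \<subseteq> (monom_fun J ` (Pi\<^sub>E J (\<lambda>j. {..<E j})) :: ((nat \<Rightarrow> 'a) \<Rightarrow> 'a) set)"
    by blast
  have fin: "finite (Pi\<^sub>E J (\<lambda>j. {..<E j}))" by (intro finite_PiE) auto
  have "card Z \<le> card (monom_fun J ` M :: ((nat \<Rightarrow> 'a) \<Rightarrow> 'a) set)"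
    by (rule card_le_card_monoms) (use assms red' finite_subset[OF sub] fin in auto)
  also have "\<dots> \<le> card (Pi\<^sub>E J (\<lambda>j. {..<E j}))"
    using card_mono[OF finite_imageI[OF fin] sub] card_image_le[OF fin] le_trans by blast
  also have "\<dots> = (\<Prod>j\<in>J. E j)" by (simp add: card_PiE)
  finally show ?thesis .
qed

section \<open>Congruence of leading terms modulo lower weight\<close>

lemma below_mult_upto: "below W F \<Longrightarrow> upto_weight W' G \<Longrightarrow> below (W + W') (\<lambda>y. F y * G y)"
  by (rule comb_mult) (auto simp: weight_add)

lemma upto_mult: "upto_weight W F \<Longrightarrow> upto_weight W' G \<Longrightarrow> upto_weight (W + W') (\<lambda>y. F y * G y)"
  by (rule comb_mult) (auto simp: weight_add)

lemma upto_power: "upto_weight W F \<Longrightarrow> upto_weight (k * W) (\<lambda>y. F y ^ k)"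
  by (induction k) (auto intro: comb_const upto_mult)

lemma below_upto: "below W F \<Longrightarrow> upto_weight W F"
  by (rule comb_mono) auto

text \<open>In \<open>(F - G) * F' + (F' - G') * G\<close> each summand keeps one factor of low
  weight, so leading terms may be multiplied.\<close>

lemma below_mult_cong:
  assumes "below W (\<lambda>y. F y - G y)" "below W' (\<lambda>y. F' y - G' y)"
    and "upto_weight W G" "upto_weight W' F'"
  shows "below (W + W') (\<lambda>y. F y * F' y - G y * G' y)"
proof -
  have "below (W + W') (\<lambda>y. (F y - G y) * F' y)" by (rule below_mult_upto) (use assms in auto)
  moreover have "below (W' + W) (\<lambda>y. (F' y - G' y) * G y)" by (rule below_mult_upto) (use assms in auto)
  ultimately have "below (W + W') (\<lambda>y. (F y - G y) * F' y + (F' y - G' y) * G y)"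
    by (intro comb_add) (auto simp: add.commute)
  then show ?thesis by (simp add: algebra_simps)
qed

lemma below_power_cong:
  assumes "below W (\<lambda>y. F y - G y)" "upto_weight W G" "upto_weight W F"
  shows "below (k * W) (\<lambda>y. F y ^ k - G y ^ k)"
proof (induction k)
  case (Suc k)
  have "below (W + k * W) (\<lambda>y. F y * F y ^ k - G y * G y ^ k)"
    by (rule below_mult_cong) (use assms Suc upto_power in auto)
  then show ?case by simp
qed (simp add: comb_zero)

lemma below_power:
  assumes "below W F" "k > 0"
  shows "below (k * W) (\<lambda>y. F y ^ k)"
  using below_power_cong[of W F "\<lambda>_. 0" k] assms by (simp add: comb_zero below_upto power_0_left)

end

section \<open>Subspaces over a finite subfield\<close>

text \<open>A subfield is a set inside a field type: its size varies, and a field and its quadratic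
  extension are needed in one type.\<close>

locale finite_subfield =
  fixes S :: "'a::field set"
  assumes finite_S [simp]: "finite S"
    and zero_S [simp]: "0 \<in> S" and one_S [simp]: "1 \<in> S"
    and add_S [simp]: "x \<in> S \<Longrightarrow> y \<in> S \<Longrightarrow> x + y \<in> S"
    and mult_S [simp]: "x \<in> S \<Longrightarrow> y \<in> S \<Longrightarrow> x * y \<in> S"
    and uminus_S [simp]: "x \<in> S \<Longrightarrow> - x \<in> S"
    and inverse_S [simp]: "x \<in> S \<Longrightarrow> inverse x \<in> S"
begin

lemma diff_S [simp]: "x \<in> S \<Longrightarrow> y \<in> S \<Longrightarrow> x - y \<in> S"
  using add_S[of x "- y"] by simp

lemma divide_S [simp]: "x \<in> S \<Longrightarrow> y \<in> S \<Longrightarrow> x / y \<in> S"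
  by (simp add: field_class.field_divide_inverse)

lemma power_S [simp]: "x \<in> S \<Longrightarrow> x ^ k \<in> S"
  by (induction k) auto

lemma sum_S: "(\<And>i. i \<in> I \<Longrightarrow> f i \<in> S) \<Longrightarrow> sum f I \<in> S"
  by (induction I rule: infinite_finite_induct) auto

lemma card_S_ge_2: "card S \<ge> 2"
proof -
  have "card {0, 1 :: 'a} \<le> card S" by (rule card_mono) auto
  then show ?thesis by simp
qed

text \<open>Vectors are continued by zero instead of being extensional, so that pointwise sums and
  multiples are again vectors.\<close>

definition vecs :: "nat \<Rightarrow> (nat \<Rightarrow> 'a) set" where
  "vecs n = {v. (\<forall>i. v i \<in> S) \<and> (\<forall>i\<ge>n. v i = 0)}"

definition subsp :: "(nat \<Rightarrow> 'a) set \<Rightarrow> bool" where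
  "subsp U \<longleftrightarrow> (\<lambda>_. 0) \<in> U \<and> (\<forall>x\<in>U. \<forall>y\<in>U. (\<lambda>i. x i + y i) \<in> U) \<and>
     (\<forall>c\<in>S. \<forall>x\<in>U. (\<lambda>i. c * x i) \<in> U) \<and> (\<forall>x\<in>U. \<forall>i. x i \<in> S)"

lemma subspD:
  assumes "subsp U"
  shows "(\<lambda>_. 0) \<in> U"
    and "x \<in> U \<Longrightarrow> y \<in> U \<Longrightarrow> (\<lambda>i. x i + y i) \<in> U"
    and "c \<in> S \<Longrightarrow> x \<in> U \<Longrightarrow> (\<lambda>i. c * x i) \<in> U"
    and "x \<in> U \<Longrightarrow> x i \<in> S"
  using assms by (auto simp: subsp_def)

lemma subsp_diff:
  assumes "subsp U" "x \<in> U" "y \<in> U"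
  shows "(\<lambda>i. x i - y i) \<in> U"
  using subspD(2)[OF assms(1,2) subspD(3)[OF assms(1) _ assms(3), of "-1"]] by simp

lemma subsp_sum:
  assumes "subsp U" "\<And>j. j \<in> I \<Longrightarrow> v j \<in> U" "\<And>j. j \<in> I \<Longrightarrow> c j \<in> S"
  shows "(\<lambda>i. \<Sum>j\<in>I. c j * v j i) \<in> U"
  using assms(2,3)
proof (induction I rule: infinite_finite_induct)
  case (insert a I)
  then show ?case
    using subspD(2)[OF assms(1) subspD(3)[OF assms(1), of "c a" "v a"], of "\<lambda>i. \<Sum>j\<in>I. c j * v j i"]
    by simp
qed (use subspD(1)[OF assms(1)] in auto)

lemma bij_vecs: "bij_betw (\<lambda>v. restrict v {..<n}) (vecs n) ({..<n} \<rightarrow>\<^sub>E S)"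
proof (rule bij_betw_byWitness[where f' = "\<lambda>v i. if i < n then v i else 0"])
  show "\<forall>v\<in>vecs n. (\<lambda>i. if i < n then restrict v {..<n} i else 0) = v"
    by (auto simp: vecs_def fun_eq_iff)
qed (auto simp: vecs_def fun_eq_iff PiE_def extensional_def)

lemma card_vecs: "card (vecs n) = card S ^ n"
  using bij_betw_same_card[OF bij_vecs] by (simp add: card_PiE)

lemma finite_vecs [simp]: "finite (vecs n)"
  using bij_betw_finite[OF bij_vecs] by (simp add: finite_PiE)

lemma vecs_add: "v \<in> vecs n \<Longrightarrow> u \<in> vecs n \<Longrightarrow> (\<lambda>i. v i + u i) \<in> vecs n"
  and vecs_diff: "v \<in> vecs n \<Longrightarrow> u \<in> vecs n \<Longrightarrow> (\<lambda>i. v i - u i) \<in> vecs n"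
  by (auto simp: vecs_def)

text \<open>A reduced echelon basis with pivot set \<open>J\<close>. The coordinates of
  \<open>x\<close> are its own entries at the pivots, and by the leading zeros of \<open>e j\<close>
  the entry at \<open>i\<close> depends only on pivots \<open>j \<le> i\<close>. The weight
  estimates rest on this order.\<close>

definition echelon :: "nat set \<Rightarrow> (nat \<Rightarrow> nat \<Rightarrow> 'a) \<Rightarrow> (nat \<Rightarrow> 'a) set \<Rightarrow> bool" where
  "echelon J e U \<longleftrightarrow>
     (\<forall>j\<in>J. e j \<in> U \<and> (\<forall>j'\<in>J. e j j' = (if j' = j then 1 else 0)) \<and> (\<forall>i<j. e j i = 0)) \<and>
     (\<forall>x\<in>U. x = (\<lambda>i. \<Sum>j\<in>J. x j * e j i))"

lemma echelonD:
  assumes "echelon J e U"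
  shows "j \<in> J \<Longrightarrow> e j \<in> U"
    and "j \<in> J \<Longrightarrow> j' \<in> J \<Longrightarrow> e j j' = (if j' = j then 1 else 0)"
    and "j \<in> J \<Longrightarrow> i < j \<Longrightarrow> e j i = 0"
    and "x \<in> U \<Longrightarrow> x i = (\<Sum>j\<in>J. x j * e j i)"
  using assms unfolding echelon_def by (blast, blast, blast, metis)

text \<open>The pivots are the positions of the leading nonzero entries of elements of
  \<open>U\<close>. An element that vanishes at all pivots is zero, since its first nonzero position
  would be a pivot; this gives the representation.\<close>

lemma echelon_exists:
  assumes U: "subsp U" "U \<subseteq> vecs n"
  obtains J e where "J \<subseteq> {..<n}" "echelon J e U"
proof -
  define J where "J = {j. j < n \<and> (\<exists>x\<in>U. x j \<noteq> 0 \<and> (\<forall>i<j. x i = 0))}"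
  have "\<exists>x. j \<in> J \<longrightarrow> x \<in> U \<and> x j = 1 \<and> (\<forall>i<j. x i = 0)" for j
  proof (cases "j \<in> J")
    case True
    then obtain x where x: "x \<in> U" "x j \<noteq> 0" "\<forall>i<j. x i = 0" by (auto simp: J_def)
    then have "(\<lambda>i. inverse (x j) * x i) \<in> U" using subspD[OF U(1)] by auto
    with x show ?thesis by (intro exI[of _ "\<lambda>i. inverse (x j) * x i"]) auto
  qed auto
  then obtain v where v: "\<And>j. j \<in> J \<Longrightarrow> v j \<in> U \<and> v j j = 1 \<and> (\<forall>i<j. v j i = 0)" by metis
  have zero: "x = (\<lambda>_. 0)" if x: "x \<in> U" "\<And>j. j \<in> J \<Longrightarrow> x j = 0" for x
  proof (rule ccontr)
    assume "x \<noteq> (\<lambda>_. 0)"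
    then have ex: "\<exists>i. x i \<noteq> 0" by auto
    define k where "k = (LEAST i. x i \<noteq> 0)"
    have k: "x k \<noteq> 0" "\<And>i. i < k \<Longrightarrow> x i = 0"
      unfolding k_def using LeastI_ex[OF ex] not_less_Least by blast+
    have "k < n" using k(1) x(1) U(2) by (force simp: vecs_def not_less[symmetric])
    then have "k \<in> J" using k x(1) by (auto simp: J_def)
    then show False using x(2) k(1) by auto
  qed
  \<comment> \<open>Elimination from left to right: up to stage \<open>m\<close> the pivots between
    \<open>j\<close> and \<open>m\<close> are cleared. Subtracting a multiple of \<open>v m\<close>
    changes nothing before position \<open>m\<close>.\<close>
  have "\<exists>e\<in>U. e j = 1 \<and> (\<forall>i<j. e i = 0) \<and> (\<forall>j'\<in>J. j < j' \<and> j' < m \<longrightarrow> e j' = 0)"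
    if j: "j \<in> J" for j m
  proof (induction m)
    case 0
    then show ?case using v[OF j] by auto
  next
    case (Suc m)
    then obtain e where e: "e \<in> U" "e j = 1" "\<forall>i<j. e i = 0"
      "\<forall>j'\<in>J. j < j' \<and> j' < m \<longrightarrow> e j' = 0" by auto
    show ?case
    proof (cases "m \<in> J \<and> j < m")
      case True
      have "(\<lambda>i. e m * v m i) \<in> U" using True v subspD[OF U(1)] e(1) by blast
      then have "(\<lambda>i. e i - e m * v m i) \<in> U" using subsp_diff[OF U(1) e(1)] by simp
      moreover have "e i - e m * v m i = e i" if "i < m" for i using v[of m] True that by simp
      ultimately show ?thesis
        using e True v[of m] by (intro bexI[of _ "\<lambda>i. e i - e m * v m i"]) (auto simp: less_Suc_eq)
    next
      case False
      then show ?thesis using e by (intro bexI[of _ e]) (auto simp: less_Suc_eq)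
    qed
  qed
  then have "\<exists>e. j \<in> J \<longrightarrow> e \<in> U \<and> e j = 1 \<and> (\<forall>i<j. e i = 0) \<and> (\<forall>j'\<in>J. j < j' \<and> j' < n \<longrightarrow> e j' = 0)" for j
    by meson
  then obtain e where e: "\<And>j. j \<in> J \<Longrightarrow> e j \<in> U \<and> e j j = 1 \<and> (\<forall>i<j. e j i = 0) \<and>
      (\<forall>j'\<in>J. j < j' \<and> j' < n \<longrightarrow> e j j' = 0)" by metis
  have Jn: "J \<subseteq> {..<n}" by (auto simp: J_def)
  have dual: "e j j' = (if j' = j then 1 else 0)" if "j \<in> J" "j' \<in> J" for j j'
    using e[OF that(1)] that Jn by (cases j j' rule: linorder_cases) auto
  have rep: "x = (\<lambda>i. \<Sum>j\<in>J. x j * e j i)" if x: "x \<in> U" for x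
  proof -
    define y where "y = (\<lambda>i. x i - (\<Sum>j\<in>J. x j * e j i))"
    have "y \<in> U"
      unfolding y_def by (intro subsp_diff[OF U(1) x] subsp_sum[OF U(1)]) (use e subspD(4)[OF U(1) x] in auto)
    moreover have "y k = 0" if k: "k \<in> J" for k
    proof -
      have "(\<Sum>j\<in>J. x j * e j k) = (\<Sum>j\<in>J. if j = k then x j else 0)"
        by (intro sum.cong) (auto simp: dual k)
      then show ?thesis using k finite_subset[OF Jn] by (simp add: y_def)
    qed
    ultimately have "y = (\<lambda>_. 0)" using zero by blast
    then have diff: "x i - (\<Sum>j\<in>J. x j * e j i) = 0" for i unfolding y_def by (rule fun_cong)
    show ?thesis by (rule ext, rule iffD1[OF right_minus_eq], rule diff)
  qed
  have "echelon J e U"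
    unfolding echelon_def
  proof (intro conjI ballI)
    fix j j' assume "j \<in> J" "j' \<in> J"
    then show "e j j' = (if j' = j then 1 else 0)" by (rule dual)
  next
    fix j assume "j \<in> J"
    then show "e j \<in> U" "\<forall>i<j. e j i = 0" using e by blast+
  next
    fix x assume "x \<in> U"
    then show "x = (\<lambda>i. \<Sum>j\<in>J. x j * e j i)" by (rule rep)
  qed
  with Jn show ?thesis by (rule that)
qed

lemma echelon_card:
  assumes "subsp U" "echelon J e U" "finite J"
  shows "card U = card S ^ card J"
proof -
  have "bij_betw (\<lambda>x. restrict x J) U (J \<rightarrow>\<^sub>E S)"
  proof (rule bij_betw_byWitness[where f' = "\<lambda>c i. \<Sum>j\<in>J. c j * e j i"])
    show "\<forall>x\<in>U. (\<lambda>i. \<Sum>j\<in>J. restrict x J j * e j i) = x"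
    proof
      fix x assume "x \<in> U"
      then have "x = (\<lambda>i. \<Sum>j\<in>J. x j * e j i)" using assms(2) unfolding echelon_def by blast
      then show "(\<lambda>i. \<Sum>j\<in>J. restrict x J j * e j i) = x" by (simp cong: sum.cong)
    qed
    show "\<forall>c\<in>J \<rightarrow>\<^sub>E S. restrict (\<lambda>i. \<Sum>j\<in>J. c j * e j i) J = c"
    proof (intro ballI ext)
      fix c i assume c: "c \<in> J \<rightarrow>\<^sub>E S"
      show "restrict (\<lambda>i. \<Sum>j\<in>J. c j * e j i) J i = c i"
      proof (cases "i \<in> J")
        case True
        have "(\<Sum>j\<in>J. c j * e j i) = (\<Sum>j\<in>J. if j = i then c j else 0)"
          using echelonD(2)[OF assms(2) _ True] by (intro sum.cong) auto
        then show ?thesis using True assms(3) by simp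
      next
        case False
        then show ?thesis using c by (auto simp: PiE_def extensional_def)
      qed
    qed
    show "(\<lambda>x. restrict x J) ` U \<subseteq> J \<rightarrow>\<^sub>E S" using subspD(4)[OF assms(1)] by auto
    show "(\<lambda>c i. \<Sum>j\<in>J. c j * e j i) ` (J \<rightarrow>\<^sub>E S) \<subseteq> U"
    proof (rule image_subsetI)
      fix c assume "c \<in> J \<rightarrow>\<^sub>E S"
      then show "(\<lambda>i. \<Sum>j\<in>J. c j * e j i) \<in> U"
        using echelonD(1)[OF assms(2)] by (intro subsp_sum[OF assms(1)]) auto
    qed
  qed
  from bij_betw_same_card[OF this] show ?thesis using assms(3) by (simp add: card_PiE)
qed

text \<open>Orthogonality to \<open>e j\<close> expresses \<open>y j\<close> by non-pivot entries,
  so \<open>y\<close> is determined by \<open>n - card J\<close> of its entries.\<close>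

lemma card_annihilator_le:
  assumes "echelon J e U" "J \<subseteq> {..<n}" "Y \<subseteq> vecs n"
    and orth: "\<And>x y. x \<in> U \<Longrightarrow> y \<in> Y \<Longrightarrow> (\<Sum>i<n. x i * y i) = 0"
  shows "card Y \<le> card S ^ (n - card J)"
proof -
  have finJ: "finite J" using assms(2) finite_subset by blast
  have coord: "y j = - (\<Sum>i\<in>{..<n} - J. e j i * y i)" if "y \<in> Y" "j \<in> J" for y j
  proof -
    have "0 = (\<Sum>i<n. e j i * y i)" using orth[OF echelonD(1)[OF assms(1) that(2)] that(1)] by simp
    also have "\<dots> = (\<Sum>i\<in>J. e j i * y i) + (\<Sum>i\<in>{..<n} - J. e j i * y i)"
      using sum.subset_diff[OF assms(2), of "\<lambda>i. e j i * y i"] by (simp add: add.commute)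
    also have "(\<Sum>i\<in>J. e j i * y i) = (\<Sum>i\<in>J. if i = j then y i else 0)"
      using echelonD(2)[OF assms(1) that(2)] by (intro sum.cong) auto
    also have "\<dots> = y j" using finJ that by simp
    finally show ?thesis by (simp add: eq_neg_iff_add_eq_0)
  qed
  have inj: "inj_on (\<lambda>y. restrict y ({..<n} - J)) Y"
  proof (rule inj_onI)
    fix y z assume yz: "y \<in> Y" "z \<in> Y" "restrict y ({..<n} - J) = restrict z ({..<n} - J)"
    have out: "y i = z i" if "i \<in> {..<n} - J" for i using fun_cong[OF yz(3), of i] that by simp
    have "y i = z i" if "i \<in> J" for i
      unfolding coord[OF yz(1) that] coord[OF yz(2) that] using out by (intro arg_cong[where f = uminus] sum.cong) auto
    moreover have "y i = z i" if "i \<ge> n" for i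
      using that subsetD[OF assms(3) yz(1)] subsetD[OF assms(3) yz(2)] by (simp add: vecs_def)
    ultimately show "y = z" using out by (metis Diff_iff ext lessThan_iff not_less)
  qed
  have "(\<lambda>y. restrict y ({..<n} - J)) ` Y \<subseteq> ({..<n} - J) \<rightarrow>\<^sub>E S"
    using assms(3) by (intro image_subsetI restrict_PiE_iff[THEN iffD2]) (auto simp: vecs_def)
  then have "card Y \<le> card (({..<n} - J) \<rightarrow>\<^sub>E S)"
    by (rule card_inj_on_le[OF inj]) (simp add: finite_PiE)
  also have "\<dots> = card S ^ (n - card J)"
    using assms(2) finJ by (simp add: card_PiE card_Diff_subset)
  finally show ?thesis .
qed

text \<open>The Witt index bound: adding a hyperbolic plane to an anisotropic form raises the size of a
  totally isotropic subspace at most by a factor of the field size.\<close>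

lemma card_isotropic_le:
  fixes R :: "(nat \<Rightarrow> 'a) \<Rightarrow> 'a"
  assumes R_cong: "\<And>u u'. (\<And>i. i \<ge> 2 * m \<Longrightarrow> u i = u' i) \<Longrightarrow> R u = R u'"
    and aniso: "\<And>u i. u \<in> vecs N \<Longrightarrow> R u = 0 \<Longrightarrow> i \<ge> 2 * m \<Longrightarrow> u i = 0"
    and "subsp Y" "Y \<subseteq> vecs N" "l \<le> m"
    and "\<And>u i. u \<in> Y \<Longrightarrow> 2 * l \<le> i \<Longrightarrow> i < 2 * m \<Longrightarrow> u i = 0"
    and "\<And>u. u \<in> Y \<Longrightarrow> (\<Sum>i<l. u (2 * i) * u (2 * i + 1)) + R u = 0"
  shows "card Y \<le> card S ^ l"
  using assms(3-)
proof (induction l arbitrary: Y)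
  case 0
  have "u = (\<lambda>_. 0)" if "u \<in> Y" for u
  proof
    fix i show "u i = 0"
      using 0(4)[OF that, of i] aniso[of u i] 0(5)[OF that] subsetD[OF 0(2) that]
      by (cases "i < 2 * m") auto
  qed
  then have "Y \<subseteq> {\<lambda>_. 0}" by auto
  then show ?case using card_mono[of "{\<lambda>_. 0}" Y] by simp
next
  case (Suc l)
  define a where "a = 2 * l"
  define b where "b = 2 * l + 1"
  have ab: "a \<noteq> b" "a < 2 * m" "b < 2 * m" using Suc.prems(3) by (auto simp: a_def b_def)
  \<comment> \<open>On \<open>Y0\<close> the product of the coordinates \<open>a\<close> and
    \<open>b\<close> vanishes, so coordinate \<open>a\<close> can be set to zero without losing
    isotropy, and one hyperbolic plane is gone.\<close>
  define Y0 where "Y0 = {u \<in> Y. u b = 0}"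
  define Y' where "Y' = (\<lambda>u. u(a := 0)) ` Y0"
  have "finite Y" using finite_subset[OF Suc.prems(2) finite_vecs] .
  then have fin: "finite Y0" "finite Y'" by (auto simp: Y0_def Y'_def)
  have Y0: "subsp Y0" using Suc.prems(1) by (auto simp: subsp_def Y0_def)
  have Y': "subsp Y'"
    unfolding subsp_def
  proof (intro conjI ballI allI)
    show "(\<lambda>_. 0) \<in> Y'" unfolding Y'_def by (rule image_eqI[OF _ subspD(1)[OF Y0]]) auto
  next
    fix x y assume "x \<in> Y'" "y \<in> Y'"
    then obtain u v where uv: "u \<in> Y0" "v \<in> Y0" "x = u(a := 0)" "y = v(a := 0)" by (auto simp: Y'_def)
    show "(\<lambda>i. x i + y i) \<in> Y'" unfolding Y'_def
      by (rule image_eqI[OF _ subspD(2)[OF Y0 uv(1,2)]]) (auto simp: uv)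
  next
    fix c x assume "c \<in> S" "x \<in> Y'"
    then obtain u where u: "u \<in> Y0" "x = u(a := 0)" by (auto simp: Y'_def)
    show "(\<lambda>i. c * x i) \<in> Y'" unfolding Y'_def
      by (rule image_eqI[OF _ subspD(3)[OF Y0 \<open>c \<in> S\<close> u(1)]]) (auto simp: u)
  next
    fix x i assume "x \<in> Y'"
    then show "x i \<in> S" using subspD(4)[OF Y0] by (auto simp: Y'_def)
  qed
  have low: "(\<Sum>i<l. u (2 * i) * u (2 * i + 1)) = (\<Sum>i<l. u' (2 * i) * u' (2 * i + 1))"
    if "\<And>i. i \<noteq> a \<Longrightarrow> i \<noteq> b \<Longrightarrow> u i = u' i" for u u'
    by (intro sum.cong refl) (use that in \<open>auto simp: a_def b_def\<close>)
  have "card Y' \<le> card S ^ l"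
  proof (rule Suc.IH[OF Y'])
    show "Y' \<subseteq> vecs N" using Suc.prems(2) by (auto simp: Y'_def Y0_def vecs_def)
    show "x i = 0" if "x \<in> Y'" "2 * l \<le> i" "i < 2 * m" for x i
    proof -
      obtain u where u: "u \<in> Y0" "x = u(a := 0)" using \<open>x \<in> Y'\<close> by (auto simp: Y'_def)
      have "i = a \<or> i = b \<or> 2 * Suc l \<le> i" using that(2) unfolding a_def b_def by presburger
      then consider "i = a" | "i = b" | "2 * Suc l \<le> i" by blast
      then show ?thesis using u Suc.prems(4)[of u i] that by cases (auto simp: Y0_def)
    qed
    show "(\<Sum>i<l. x (2 * i) * x (2 * i + 1)) + R x = 0" if "x \<in> Y'" for x
    proof -
      obtain u where u: "u \<in> Y0" "x = u(a := 0)" using \<open>x \<in> Y'\<close> by (auto simp: Y'_def)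
      have "R x = R u" by (rule R_cong) (use u ab in auto)
      moreover have "(\<Sum>i<l. x (2 * i) * x (2 * i + 1)) = (\<Sum>i<l. u (2 * i) * u (2 * i + 1))"
        by (rule low) (use u in auto)
      ultimately show ?thesis using Suc.prems(5)[of u] u(1) by (simp add: Y0_def a_def b_def)
    qed
  qed (use Suc.prems(3) in simp)
  \<comment> \<open>If forgetting coordinate \<open>a\<close> is injective on \<open>Y0\<close>,
    then \<open>Y'\<close> is as large as \<open>Y0\<close>, which has at most \<open>card S\<close>
    cosets in \<open>Y\<close>. Otherwise \<open>Y\<close> contains a vector supported on
    \<open>a\<close> alone; this forces coordinate \<open>b\<close> to vanish on \<open>Y\<close>,
    and only coordinate \<open>a\<close> is lost on the way to \<open>Y'\<close>.\<close>
  moreover have "card Y \<le> card S * card Y'"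
  proof (cases "inj_on (\<lambda>u. u(a := 0)) Y0")
    case True
    have "\<exists>r. c \<in> (\<lambda>u. u b) ` Y \<longrightarrow> r \<in> Y \<and> r b = c" for c by auto
    then obtain r where r: "\<And>c. c \<in> (\<lambda>u. u b) ` Y \<Longrightarrow> r c \<in> Y \<and> r c b = c" by metis
    define \<phi> where "\<phi> u = (u b, (\<lambda>i. u i - r (u b) i))" for u
    have "inj_on \<phi> Y" by (rule inj_onI) (auto simp: \<phi>_def fun_eq_iff)
    moreover have "\<phi> ` Y \<subseteq> S \<times> Y0"
    proof
      fix p assume "p \<in> \<phi> ` Y"
      then obtain u where u: "u \<in> Y" "p = \<phi> u" by auto
      have "r (u b) \<in> Y" "r (u b) b = u b" using r[of "u b"] u(1) by auto
      then show "p \<in> S \<times> Y0"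
        using subsp_diff[OF Suc.prems(1) u(1)] u subspD(4)[OF Suc.prems(1)] by (auto simp: \<phi>_def Y0_def)
    qed
    ultimately have "card Y \<le> card (S \<times> Y0)" by (rule card_inj_on_le) (use fin in auto)
    then show ?thesis using card_image[OF True] by (simp add: Y'_def card_cartesian_product)
  next
    case False
    then obtain u v where uv: "u \<in> Y0" "v \<in> Y0" "u(a := 0) = v(a := 0)" "u \<noteq> v" by (auto simp: inj_on_def)
    define d where "d = (\<lambda>i. u i - v i)"
    have d: "d \<in> Y0" unfolding d_def by (rule subsp_diff[OF Y0 uv(1,2)])
    have d0: "d i = 0" if "i \<noteq> a" for i using fun_cong[OF uv(3), of i] that by (simp add: d_def)
    have da: "d a \<noteq> 0" using uv(4) d0 by (force simp: d_def fun_eq_iff)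
    have "y b = 0" if y: "y \<in> Y" for y
    proof -
      \<comment> \<open>Adding \<open>d\<close> changes the value of the form by
        \<open>d a * y b\<close>, but both \<open>y\<close> and \<open>z\<close> are
        isotropic.\<close>
      define z where "z = (\<lambda>i. y i + d i)"
      have z: "z \<in> Y" unfolding z_def using subspD(2)[OF Suc.prems(1) y] d by (auto simp: Y0_def)
      have "R z = R y" by (rule R_cong) (use d0 ab in \<open>auto simp: z_def\<close>)
      moreover have "(\<Sum>i<l. z (2 * i) * z (2 * i + 1)) = (\<Sum>i<l. y (2 * i) * y (2 * i + 1))"
        by (rule low) (use d0 in \<open>auto simp: z_def\<close>)
      moreover have "(\<Sum>i<l. z (2 * i) * z (2 * i + 1)) + z a * z b + R z = 0"
        "(\<Sum>i<l. y (2 * i) * y (2 * i + 1)) + y a * y b + R y = 0"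
        using Suc.prems(5)[OF z] Suc.prems(5)[OF y] by (simp_all add: a_def b_def)
      ultimately have "z a * z b = y a * y b" by (simp add: add_eq_0_iff2 add.assoc)
      then have "d a * y b = 0" using d0[of b] ab(1) by (simp add: z_def distrib_right)
      then show ?thesis using da by simp
    qed
    then have YY: "Y0 = Y" by (auto simp: Y0_def)
    define \<phi> where "\<phi> u = (u a, u(a := 0))" for u :: "nat \<Rightarrow> 'a"
    have "inj_on \<phi> Y"
    proof (rule inj_onI)
      fix u v assume "\<phi> u = \<phi> v"
      then have "u a = v a" "u(a := 0) = v(a := 0)" by (auto simp: \<phi>_def)
      then show "u = v" by (metis fun_upd_triv fun_upd_upd)
    qed
    moreover have "\<phi> ` Y \<subseteq> S \<times> Y'"
      using subspD(4)[OF Suc.prems(1)] by (auto simp: \<phi>_def Y'_def YY)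
    ultimately have "card Y \<le> card (S \<times> Y')" by (rule card_inj_on_le) (use fin in auto)
    then show ?thesis by (simp add: card_cartesian_product)
  qed
  ultimately show ?case by (auto intro: order_trans[OF _ mult_le_mono2])
qed

end

section \<open>Leading monomials\<close>

lemma ternary_less: "(\<And>j. j < n \<Longrightarrow> e j \<le> 2) \<Longrightarrow> (\<Sum>j<n. 3 ^ j * e j) < (3 :: nat) ^ n"
proof (induction n)
  case (Suc n)
  have "3 ^ n * e n \<le> 3 ^ n * 2" using Suc.prems[of n] by (intro mult_le_mono2) auto
  moreover have "(\<Sum>j<n. 3 ^ j * e j) < 3 ^ n" using Suc by simp
  ultimately show ?case unfolding sum.lessThan_Suc power_Suc by linarith
qed simp

lemma ternary_inj:
  assumes "\<And>j. j < n \<Longrightarrow> e j \<le> 2" "\<And>j. j < n \<Longrightarrow> e' j \<le> 2"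
    and "(\<Sum>j<n. 3 ^ j * e j) = (\<Sum>j<n. (3 :: nat) ^ j * e' j)"
  shows "j < n \<Longrightarrow> e j = e' j"
  using assms
proof (induction n)
  case (Suc n)
  have lt: "(\<Sum>j<n. 3 ^ j * e j) < (3 :: nat) ^ n" "(\<Sum>j<n. 3 ^ j * e' j) < (3 :: nat) ^ n"
    using Suc.prems by (auto intro!: ternary_less)
  have "(3 ^ n * e n + (\<Sum>j<n. 3 ^ j * e j)) div 3 ^ n = (3 ^ n * e' n + (\<Sum>j<n. (3 :: nat) ^ j * e' j)) div 3 ^ n"
    using Suc.prems(4) by (simp add: add.commute)
  then have top: "e n = e' n" using lt by simp
  with Suc.prems(4) have "(\<Sum>j<n. 3 ^ j * e j) = (\<Sum>j<n. (3 :: nat) ^ j * e' j)" by simp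
  with Suc.IH Suc.prems top show ?case by (auto simp: less_Suc_eq)
qed simp

context polynomial_functions
begin

text \<open>The two upper bounds accompany the congruence because the induction step through
  \<open>below_mult_cong\<close> needs them.\<close>

lemma below_prod_cong:
  assumes "finite I" "\<And>i. i \<in> I \<Longrightarrow> below (V i) (\<lambda>y. F i y - G i y)"
    and "\<And>i. i \<in> I \<Longrightarrow> upto_weight (V i) (F i)" "\<And>i. i \<in> I \<Longrightarrow> upto_weight (V i) (G i)"
  shows "upto_weight (\<Sum>i\<in>I. V i) (\<lambda>y. \<Prod>i\<in>I. F i y) \<and> upto_weight (\<Sum>i\<in>I. V i) (\<lambda>y. \<Prod>i\<in>I. G i y) \<and>
    below (\<Sum>i\<in>I. V i) (\<lambda>y. (\<Prod>i\<in>I. F i y) - (\<Prod>i\<in>I. G i y))"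
  using assms
proof (induction I rule: finite_induct)
  case empty
  then show ?case by (simp add: comb_zero comb_const)
next
  case (insert a I)
  then have IH: "upto_weight (\<Sum>i\<in>I. V i) (\<lambda>y. \<Prod>i\<in>I. F i y)" "upto_weight (\<Sum>i\<in>I. V i) (\<lambda>y. \<Prod>i\<in>I. G i y)"
    "below (\<Sum>i\<in>I. V i) (\<lambda>y. (\<Prod>i\<in>I. F i y) - (\<Prod>i\<in>I. G i y))" by auto
  have "below (V a + (\<Sum>i\<in>I. V i)) (\<lambda>y. F a y * (\<Prod>i\<in>I. F i y) - G a y * (\<Prod>i\<in>I. G i y))"
    by (rule below_mult_cong) (use IH insert.prems in auto)
  moreover have "upto_weight (V a + (\<Sum>i\<in>I. V i)) (\<lambda>y. F a y * (\<Prod>i\<in>I. F i y))"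
    by (rule upto_mult) (use IH insert.prems in auto)
  moreover have "upto_weight (V a + (\<Sum>i\<in>I. V i)) (\<lambda>y. G a y * (\<Prod>i\<in>I. G i y))"
    by (rule upto_mult) (use IH insert.prems in auto)
  ultimately show ?case using insert.hyps by simp
qed

end

text \<open>Exponents at most 2 in each variable are the digits of the weight in base 3, so that a nonzero
  polynomial of this kind has a unique monomial of maximal weight.\<close>

definition exps :: "nat set \<Rightarrow> nat \<Rightarrow> (nat \<Rightarrow> nat) set" where
  "exps J k = {e. (\<forall>j\<in>J. e j \<le> k) \<and> (\<forall>j. j \<notin> J \<longrightarrow> e j = 0)}"

lemma finite_exps: "finite J \<Longrightarrow> finite (exps J k)"
proof -
  assume "finite J"
  then have "finite {e. \<forall>j. (j \<in> J \<longrightarrow> e j \<in> {..k}) \<and> (j \<notin> J \<longrightarrow> e j = 0)}"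
    by (rule finite_set_of_finite_funs) simp
  then show ?thesis by (rule finite_subset[rotated]) (auto simp: exps_def)
qed

locale ternary_functions = polynomial_functions J Z "\<lambda>j. 3 ^ j" for J and Z :: "(nat \<Rightarrow> 'a::field) set" +
  fixes n :: nat
  assumes J_less: "J \<subseteq> {..<n}"
begin

lemma weight_inj: "inj_on weight (exps J 2)"
proof (rule inj_onI, rule ext)
  fix e e' j assume e: "e \<in> exps J 2" "e' \<in> exps J 2" "weight e = weight e'"
  have conv: "weight e = (\<Sum>j<n. 3 ^ j * e j)" if "e \<in> exps J 2" for e
    unfolding weight_def by (rule sum.mono_neutral_left) (use J_less that in \<open>auto simp: exps_def\<close>)
  have le: "e j \<le> 2" if "e \<in> exps J 2" for e j using that by (cases "j \<in> J") (auto simp: exps_def)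
  show "e j = e' j"
  proof (cases "j < n")
    case True
    show ?thesis by (rule ternary_inj[OF _ _ _ True]) (use e conv le in auto)
  next
    case False
    then have "j \<notin> J" using J_less by auto
    then show ?thesis using e by (auto simp: exps_def)
  qed
qed

lemma comb_exps:
  assumes "comb (exps J k) g"
  shows "\<exists>c. \<forall>u\<in>Z. g u = (\<Sum>e\<in>exps J k. c e * monom_fun J e u)"
  using assms
proof (rule comb_induct[where P = "\<lambda>g. \<exists>c. \<forall>u\<in>Z. g u = (\<Sum>e\<in>exps J k. c e * monom_fun J e u)"])
  fix e assume e: "e \<in> exps J k"
  show "\<exists>c. \<forall>u\<in>Z. monom_fun J e u = (\<Sum>e\<in>exps J k. c e * monom_fun J e u)"
    by (rule exI[of _ "\<lambda>e'. if e' = e then 1 else 0"])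
      (use e finite_exps[of J k] in \<open>simp add: if_distrib[of "\<lambda>x. x * _"] cong: if_cong\<close>)
next
  show "\<exists>c. \<forall>u\<in>Z. (0::'a) = (\<Sum>e\<in>exps J k. c e * monom_fun J e u)"
    by (rule exI[of _ "\<lambda>_. 0"]) simp
next
  fix F G assume "\<exists>c. \<forall>u\<in>Z. F u = (\<Sum>e\<in>exps J k. c e * monom_fun J e u)"
    "\<exists>c. \<forall>u\<in>Z. G u = (\<Sum>e\<in>exps J k. c e * monom_fun J e u)"
  then obtain c c' where "\<forall>u\<in>Z. F u = (\<Sum>e\<in>exps J k. c e * monom_fun J e u)"
    "\<forall>u\<in>Z. G u = (\<Sum>e\<in>exps J k. c' e * monom_fun J e u)" by blast
  then show "\<exists>c. \<forall>u\<in>Z. F u + G u = (\<Sum>e\<in>exps J k. c e * monom_fun J e u)"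
    by (intro exI[of _ "\<lambda>e. c e + c' e"]) (simp add: sum.distrib distrib_right)
next
  fix a F assume "\<exists>c. \<forall>u\<in>Z. F u = (\<Sum>e\<in>exps J k. c e * monom_fun J e u)"
  then obtain c where "\<forall>u\<in>Z. F u = (\<Sum>e\<in>exps J k. c e * monom_fun J e u)" by blast
  then show "\<exists>c. \<forall>u\<in>Z. a * F u = (\<Sum>e\<in>exps J k. c e * monom_fun J e u)"
    by (intro exI[of _ "\<lambda>e. a * c e"]) (simp add: sum_distrib_left mult.assoc)
qed auto

text \<open>If the leading terms of the curve equations identify all \<open>u l ^ 3 ^ (n - l)\<close> up to nonzero
  factors, then a quadratic equation bounds the set, because its leading monomial becomes a power of
  the single variable \<open>u k\<close>.\<close>

lemma card_curve_quadric_le: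
  assumes "finite Z" and sep: "\<And>z z'. z \<in> Z \<Longrightarrow> z' \<in> Z \<Longrightarrow> (\<And>j. j \<in> J \<Longrightarrow> z j = z' j) \<Longrightarrow> z = z'"
    and k: "k \<in> J"
    and curve: "\<And>l. l \<in> J \<Longrightarrow> \<gamma> l \<noteq> 0 \<and> below (3 ^ n) (\<lambda>u. u l ^ 3 ^ (n - l) - \<gamma> l * u k ^ 3 ^ (n - k))"
    and g: "\<And>u. u \<in> Z \<Longrightarrow> (\<Sum>e\<in>exps J 2. c e * monom_fun J e u) = 0"
    and c: "e0 \<in> exps J 2" "c e0 \<noteq> 0"
  shows "card Z \<le> (3 ^ n * (2 * n * 3 ^ n + 1)) ^ n"
proof -
  define T where "T = {e \<in> exps J 2. c e \<noteq> 0}"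
  have T: "finite T" "T \<noteq> {}" using c finite_exps[of J 2] by (auto simp: T_def)
  obtain t where t: "t \<in> T" and tmax: "\<And>e. e \<in> T \<Longrightarrow> weight e \<le> weight t"
  proof -
    have "Max (weight ` T) \<in> weight ` T" using T by (intro Max_in) auto
    then obtain t where "t \<in> T" "weight t = Max (weight ` T)" by auto
    then show thesis using that[of t] T(1) by auto
  qed
  have tJ: "t \<in> exps J 2" "c t \<noteq> 0" using t by (auto simp: T_def)
  \<comment> \<open>The common weight of all powers \<open>u l ^ 3 ^ (n - l)\<close>.\<close>
  define D where "D = (3 :: nat) ^ n"
  define W where "W = weight t"
  have wD: "3 ^ j * 3 ^ (n - j) = D" if "j \<in> J" for j
    using J_less that unfolding D_def by (auto simp flip: power_add)
  \<comment> \<open>Distinct exponents in \<open>exps J 2\<close> have distinct weights, so the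
    quadratic relation can be solved for the monomial \<open>t\<close>, with all other monomials of
    smaller weight.\<close>
  have lead: "below W (monom_fun J t)"
  proof -
    have "below W (\<lambda>u. \<Sum>e\<in>T - {t}. (- c e / c t) * monom_fun J e u)"
    proof (rule comb_sum, rule comb_scale, rule comb_monom)
      fix e assume e: "e \<in> T - {t}"
      then have "weight e \<noteq> weight t" using inj_onD[OF weight_inj] tJ by (auto simp: T_def)
      then show "e \<in> {e. weight e < W}" using tmax[of e] e by (auto simp: W_def)
    qed
    then show ?thesis
    proof (rule comb_cong)
      fix u assume u: "u \<in> Z"
      have "0 = (\<Sum>e\<in>T. c e * monom_fun J e u)"
        unfolding g[OF u, symmetric] by (rule sum.mono_neutral_right) (auto simp: T_def finite_exps)
      also have "\<dots> = c t * monom_fun J t u + (\<Sum>e\<in>T - {t}. c e * monom_fun J e u)"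
        by (rule sum.remove[OF T(1) t])
      finally have "monom_fun J t u = - (\<Sum>e\<in>T - {t}. c e * monom_fun J e u) / c t"
        using tJ(2) by (simp add: field_simps eq_neg_iff_add_eq_0)
      then show "(\<Sum>e\<in>T - {t}. (- c e / c t) * monom_fun J e u) = monom_fun J t u"
        by (simp add: sum_negf sum_divide_distrib)
    qed
  qed
  have var: "upto_weight D (\<lambda>u. u j ^ 3 ^ (n - j))" if "j \<in> J" for j
    by (rule comb_power_var) (use that wD in \<open>auto simp: weight_single\<close>)
  have var': "upto_weight D (\<lambda>u. a * u k ^ 3 ^ (n - k))" for a
    by (rule comb_scale[OF var[OF k]])
  \<comment> \<open>In the \<open>D\<close>-th power of the leading monomial the factor of index
    \<open>j\<close> is \<open>(u j ^ 3 ^ (n - j)) ^ V j\<close>, to which the curve congruence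
    applies. The result is a nonzero multiple of a power of \<open>u k\<close> alone.\<close>
  define V where "V j = 3 ^ j * t j" for j
  have V: "(\<Sum>j\<in>J. V j * D) = D * W" by (simp add: V_def W_def weight_def sum_distrib_left mult_ac)
  define \<Gamma> where "\<Gamma> = (\<Prod>j\<in>J. \<gamma> j ^ V j)"
  have \<Gamma>: "\<Gamma> \<noteq> 0" using curve by (simp add: \<Gamma>_def)
  have "below (\<Sum>j\<in>J. V j * D) (\<lambda>u. (\<Prod>j\<in>J. (u j ^ 3 ^ (n - j)) ^ V j) - (\<Prod>j\<in>J. (\<gamma> j * u k ^ 3 ^ (n - k)) ^ V j))"
    by (intro below_prod_cong[THEN conjunct2, THEN conjunct2] below_power_cong upto_power)
      (use curve var var' D_def in auto)
  from this[unfolded V]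
  have diff: "below (D * W) (\<lambda>u. monom_fun J t u ^ D - \<Gamma> * u k ^ (3 ^ (n - k) * W))"
  proof (rule comb_cong)
    fix u assume "u \<in> Z"
    have "(\<Prod>j\<in>J. (u j ^ 3 ^ (n - j)) ^ V j) = monom_fun J t u ^ D"
      unfolding monom_fun_def prod_power_distrib
    proof (rule prod.cong)
      fix j assume "j \<in> J"
      then have "3 ^ (n - j) * V j = t j * D" using wD by (metis V_def mult.assoc mult.commute)
      then show "(u j ^ 3 ^ (n - j)) ^ V j = (u j ^ t j) ^ D" by (simp flip: power_mult)
    qed simp
    moreover have "(\<Prod>j\<in>J. (\<gamma> j * u k ^ 3 ^ (n - k)) ^ V j) = \<Gamma> * u k ^ (3 ^ (n - k) * W)"
      by (simp add: power_mult_distrib prod.distrib \<Gamma>_def W_def weight_def V_def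
          power_mult power_sum)
    ultimately show "(\<Prod>j\<in>J. (u j ^ 3 ^ (n - j)) ^ V j) - (\<Prod>j\<in>J. (\<gamma> j * u k ^ 3 ^ (n - k)) ^ V j) =
        monom_fun J t u ^ D - \<Gamma> * u k ^ (3 ^ (n - k) * W)" by simp
  qed
  \<comment> \<open>By \<open>lead\<close> the same power is also of lower weight, hence so is the
    power of \<open>u k\<close>.\<close>
  have "below (D * W) (\<lambda>u. monom_fun J t u ^ D)"
    by (rule below_power[OF lead]) (simp add: D_def)
  from comb_diff[OF this diff]
  have "below (D * W) (\<lambda>u. \<Gamma> * u k ^ (3 ^ (n - k) * W))" by simp
  from comb_scale[OF this, of "inverse \<Gamma>"]
  have uk: "below (D * W) (\<lambda>u. u k ^ (3 ^ (n - k) * W))" using \<Gamma> by (simp add: field_simps)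
  \<comment> \<open>The curve congruences transfer the reduction from \<open>u k\<close> to every
    variable; all these powers have weight \<open>D * W\<close>.\<close>
  have red: "below (3 ^ l * (3 ^ (n - l) * W)) (\<lambda>u. u l ^ (3 ^ (n - l) * W))" if l: "l \<in> J" for l
  proof -
    have "below (W * D) (\<lambda>u. (u l ^ 3 ^ (n - l)) ^ W - (\<gamma> l * u k ^ 3 ^ (n - k)) ^ W)"
      by (intro below_power_cong) (use curve[OF l] var[OF l] var' D_def in auto)
    from comb_add[OF this, of "\<lambda>u. \<gamma> l ^ W * u k ^ (3 ^ (n - k) * W)"] comb_scale[OF uk, of "\<gamma> l ^ W"]
    have "below (D * W) (\<lambda>u. u l ^ (3 ^ (n - l) * W))"
      by (simp add: mult.commute[of W D] power_mult_distrib power_mult)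
    then show ?thesis using wD[OF l] by (simp flip: mult.assoc)
  qed
  have "W \<le> (\<Sum>j\<in>J. 3 ^ n * 2)"
    unfolding W_def weight_def
  proof (intro sum_mono mult_le_mono)
    fix j assume "j \<in> J"
    then show "3 ^ j \<le> (3 :: nat) ^ n" "t j \<le> 2" using J_less tJ by (auto simp: exps_def)
  qed
  also have "\<dots> = card J * (3 ^ n * 2)" by simp
  also have "\<dots> \<le> n * (3 ^ n * 2)" using card_mono[OF _ J_less] by (intro mult_le_mono1) simp
  \<comment> \<open>The summand 1 keeps the base of the final bound positive for
    \<open>n = 0\<close>, as raising the exponent from \<open>card J\<close> to \<open>n\<close>
    requires.\<close>
  finally have W: "W \<le> 2 * n * 3 ^ n + 1" by simp
  have "card Z \<le> (\<Prod>l\<in>J. 3 ^ (n - l) * W)" by (rule footprint_bound[OF assms(1) sep red])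
  also have "\<dots> \<le> (\<Prod>l\<in>J. 3 ^ n * (2 * n * 3 ^ n + 1))"
    by (intro prod_mono conjI mult_le_mono W) auto
  also have "\<dots> = (3 ^ n * (2 * n * 3 ^ n + 1)) ^ card J" by simp
  also have "\<dots> \<le> (3 ^ n * (2 * n * 3 ^ n + 1)) ^ n"
  proof (rule power_increasing)
    show "card J \<le> n" using card_mono[OF _ J_less] by simp
    show "1 \<le> 3 ^ n * (2 * n * 3 ^ n + 1)" unfolding One_nat_def Suc_le_eq by simp
  qed
  finally show ?thesis .
qed

end

section \<open>Evasive varieties in characteristic 3\<close>

lemma frobenius_add:
  fixes x y :: "'a::field"
  assumes three: "(3::'a) = 0"
  shows "(x + y) ^ 3 ^ k = x ^ 3 ^ k + y ^ 3 ^ k"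
proof (induction k)
  case (Suc k)
  have cube: "(a + b) ^ 3 = a ^ 3 + b ^ 3" for a b :: 'a
  proof -
    have "(a + b) ^ 3 = a ^ 3 + b ^ 3 + 3 * (a\<^sup>2 * b + a * b\<^sup>2)"
      by (simp add: power2_eq_square power3_eq_cube algebra_simps)
    then show ?thesis by (simp add: three)
  qed
  have "(x + y) ^ 3 ^ Suc k = ((x + y) ^ 3 ^ k) ^ 3" by (simp add: mult.commute flip: power_mult)
  also have "\<dots> = (x ^ 3 ^ k) ^ 3 + (y ^ 3 ^ k) ^ 3" by (simp add: Suc.IH cube)
  finally show ?case by (simp add: mult.commute flip: power_mult)
qed simp

locale char3_subfield = finite_subfield S for S :: "'a::field set" +
  assumes three: "(3::'a) = 0"
begin

lemma two: "(2::'a) = - 1"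
proof -
  have "(2::'a) + 1 = 0" using three by simp
  then show ?thesis by (simp add: eq_neg_iff_add_eq_0)
qed

lemmas frob = frobenius_add[OF three]

lemma frob_sum: "(\<Sum>i\<in>I. f i :: 'a) ^ 3 ^ k = (\<Sum>i\<in>I. f i ^ 3 ^ k)"
  by (induction I rule: infinite_finite_induct) (auto simp: frob power_0_left)

lemma frob_diff: "((x::'a) - y) ^ 3 ^ k = x ^ 3 ^ k - y ^ 3 ^ k"
  using frob[of "x - y" y k] by (simp add: algebra_simps)

text \<open>With \<open>u = x - a\<close>, a non-pivot entry \<open>u i\<close> is a combination of
  \<open>u j\<close> with pivots \<open>j < i\<close>, and \<open>u j ^ 3 ^ (n - i)\<close> then has
  weight below \<open>3 ^ n\<close>. So only pivots contribute to the leading part of an equation.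
  Polynomials \<open>p\<close> vanishing at chosen \<open>\<alpha> i\<close> isolate single leading
  terms if \<open>card J \<le> h\<close>. For \<open>card J = Suc h\<close> they isolate pairs, and
  the quadratic \<open>G\<close> supplies the missing relation.\<close>

lemma card_evasive_le:
  assumes ech: "echelon J e U" and J: "J \<subseteq> {..<n}" and \<alpha>: "inj_on \<alpha> {..<n}" and fin: "finite Z"
    and ZU: "\<And>x. x \<in> Z \<Longrightarrow> (\<lambda>i. x i - a i) \<in> U"
    and eq: "\<And>x p. x \<in> Z \<Longrightarrow> degree p < h \<Longrightarrow> (\<Sum>i<n. poly p (\<alpha> i) * x i ^ 3 ^ (n - i)) = c p"
    and card_J: "card J \<le> h \<or> card J = Suc h \<and> (\<exists>G u. polynomial_functions.comb J UNIV (exps J 2) G \<and>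
      (\<forall>x\<in>Z. G (\<lambda>i. x i - a i) = 0) \<and> G u \<noteq> 0)"
  shows "card Z \<le> (3 ^ n * (2 * n * 3 ^ n + 1)) ^ n"
proof -
  define \<psi> where "\<psi> x = (\<lambda>i. x i - a i)" for x :: "nat \<Rightarrow> 'a"
  define Z' where "Z' = \<psi> ` Z"
  have "inj_on \<psi> Z" by (rule inj_onI) (auto simp: \<psi>_def fun_eq_iff)
  then have card_Z': "card Z' = card Z" by (simp add: Z'_def card_image)
  have finJ: "finite J" using J finite_subset by blast
  have Z'U: "Z' \<subseteq> U" using ZU by (auto simp: Z'_def \<psi>_def)
  interpret ternary_functions J Z' n
    by unfold_locales (use finJ J in auto)
  have sep: "z = z'" if "z \<in> Z'" "z' \<in> Z'" "\<And>j. j \<in> J \<Longrightarrow> z j = z' j" for z z'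
  proof
    fix i
    have "z i = (\<Sum>j\<in>J. z j * e j i)" "z' i = (\<Sum>j\<in>J. z' j * e j i)"
      using echelonD(4)[OF ech] that Z'U by blast+
    then show "z i = z' i" using that(3) by (simp cong: sum.cong)
  qed
  have rel: "below (3 ^ n) (\<lambda>u. \<Sum>i\<in>J. poly p (\<alpha> i) * u i ^ 3 ^ (n - i))" if p: "degree p < h" for p
  proof -
    \<comment> \<open>The powers are additive in characteristic 3, so the base point
      \<open>a\<close> contributes only a constant.\<close>
    define C where "C = c p - (\<Sum>i<n. poly p (\<alpha> i) * a i ^ 3 ^ (n - i))"
    have pivot: "below (3 ^ n) (\<lambda>u. \<Sum>j\<in>J. (if j < i then e j i ^ 3 ^ (n - i) else 0) * u j ^ 3 ^ (n - i))"
      if i: "i \<in> {..<n} - J" for i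
    proof (rule comb_sum)
      fix j assume j: "j \<in> J"
      show "below (3 ^ n) (\<lambda>u. (if j < i then e j i ^ 3 ^ (n - i) else 0) * u j ^ 3 ^ (n - i))"
      proof (cases "j < i")
        case True
        have "below (3 ^ n) (\<lambda>u. u j ^ 3 ^ (n - i))"
        proof (rule comb_power_var[OF j])
          have "(3::nat) ^ j * 3 ^ (n - i) < 3 ^ n"
            using True i by (auto simp flip: power_add)
          then show "(\<lambda>j'. if j' = j then 3 ^ (n - i) else 0) \<in> {e. weight e < 3 ^ n}"
            by (simp add: weight_single j)
        qed
        from comb_scale[OF this, of "e j i ^ 3 ^ (n - i)"] True show ?thesis by simp
      qed (simp add: comb_zero)
    qed
    have "below (3 ^ n) (\<lambda>u. C - (\<Sum>i\<in>{..<n} - J. poly p (\<alpha> i) *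
        (\<Sum>j\<in>J. (if j < i then e j i ^ 3 ^ (n - i) else 0) * u j ^ 3 ^ (n - i))))"
    proof (rule comb_diff)
      show "below (3 ^ n) (\<lambda>_. C)" by (rule comb_const) simp
    qed (rule comb_sum, rule comb_scale, rule pivot)
    then show ?thesis
    proof (rule comb_cong)
      fix u assume "u \<in> Z'"
      then obtain x where x: "x \<in> Z" "u = \<psi> x" by (auto simp: Z'_def)
      have uU: "u \<in> U" using \<open>u \<in> Z'\<close> Z'U by blast
      have "c p = (\<Sum>i<n. poly p (\<alpha> i) * (a i + u i) ^ 3 ^ (n - i))"
        using eq[OF x(1) p] by (simp add: x(2) \<psi>_def)
      also have "\<dots> = (\<Sum>i<n. poly p (\<alpha> i) * a i ^ 3 ^ (n - i)) + (\<Sum>i<n. poly p (\<alpha> i) * u i ^ 3 ^ (n - i))"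
        by (simp add: frob distrib_left sum.distrib)
      finally have "C = (\<Sum>i<n. poly p (\<alpha> i) * u i ^ 3 ^ (n - i))" by (simp add: C_def)
      also have "\<dots> = (\<Sum>i\<in>J. poly p (\<alpha> i) * u i ^ 3 ^ (n - i)) + (\<Sum>i\<in>{..<n} - J. poly p (\<alpha> i) * u i ^ 3 ^ (n - i))"
        using sum.subset_diff[OF J, of "\<lambda>i. poly p (\<alpha> i) * u i ^ 3 ^ (n - i)"] by (simp add: add.commute)
      also have "(\<Sum>i\<in>{..<n} - J. poly p (\<alpha> i) * u i ^ 3 ^ (n - i)) = (\<Sum>i\<in>{..<n} - J. poly p (\<alpha> i) *
        (\<Sum>j\<in>J. (if j < i then e j i ^ 3 ^ (n - i) else 0) * u j ^ 3 ^ (n - i)))"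
      proof (rule sum.cong)
        fix i assume i: "i \<in> {..<n} - J"
        have "u i ^ 3 ^ (n - i) = (\<Sum>j\<in>J. u j * e j i) ^ 3 ^ (n - i)"
          using echelonD(4)[OF ech uU, of i] by simp
        also have "\<dots> = (\<Sum>j\<in>J. (u j * e j i) ^ 3 ^ (n - i))" by (rule frob_sum)
        also have "\<dots> = (\<Sum>j\<in>J. (if j < i then e j i ^ 3 ^ (n - i) else 0) * u j ^ 3 ^ (n - i))"
        proof (rule sum.cong)
          fix j assume j: "j \<in> J"
          then have "j \<noteq> i" using i by auto
          then show "(u j * e j i) ^ 3 ^ (n - i) = (if j < i then e j i ^ 3 ^ (n - i) else 0) * u j ^ 3 ^ (n - i)"
            using echelonD(3)[OF ech j, of i] by (auto simp: power_mult_distrib)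
        qed simp
        finally show "poly p (\<alpha> i) * u i ^ 3 ^ (n - i) = poly p (\<alpha> i) *
          (\<Sum>j\<in>J. (if j < i then e j i ^ 3 ^ (n - i) else 0) * u j ^ 3 ^ (n - i))" by simp
      qed simp
      finally show "C - (\<Sum>i\<in>{..<n} - J. poly p (\<alpha> i) *
        (\<Sum>j\<in>J. (if j < i then e j i ^ 3 ^ (n - i) else 0) * u j ^ 3 ^ (n - i))) =
        (\<Sum>i\<in>J. poly p (\<alpha> i) * u i ^ 3 ^ (n - i))" by (simp only: add_diff_cancel_right')
    qed
  qed
  \<comment> \<open>The monic polynomial with roots \<open>\<alpha> j\<close> for
    \<open>j \<in> L\<close>; as \<open>\<alpha>\<close> is injective, it vanishes at no other
    \<open>\<alpha> i\<close> with \<open>i \<in> J\<close>.\<close>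
  define vp where "vp L = (\<Prod>j\<in>L. [:- \<alpha> j, 1:])" for L
  have deg_vp: "degree (vp L) = card L" for L
    unfolding vp_def by (subst degree_prod_eq_sum_degree) auto
  have vp0: "poly (vp L) (\<alpha> i) = 0 \<longleftrightarrow> i \<in> L" if "L \<subseteq> J" "i \<in> J" for L i
  proof -
    have "finite L" using that finJ finite_subset by blast
    then have "poly (vp L) (\<alpha> i) = 0 \<longleftrightarrow> (\<exists>j\<in>L. \<alpha> i = \<alpha> j)"
      by (simp add: vp_def poly_prod)
    also have "\<dots> \<longleftrightarrow> i \<in> L" using inj_onD[OF \<alpha>] that J by blast
    finally show ?thesis .
  qed
  have wl: "3 ^ l * 3 ^ (n - l) = (3::nat) ^ n" if "l \<in> J" for l
    using J that by (auto simp flip: power_add)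
  have "card Z' \<le> (3 ^ n * (2 * n * 3 ^ n + 1)) ^ n"
    using card_J
  proof (elim disjE conjE exE)
    assume card_J: "card J \<le> h"
    have "below (3 ^ l * 3 ^ (n - l)) (\<lambda>u. u l ^ 3 ^ (n - l))" if l: "l \<in> J" for l
    proof -
      define p where "p = vp (J - {l})"
      have "card (J - {l}) < card J" using finJ l by (rule card_Diff1_less)
      then have "degree p < h" using card_J by (simp add: p_def deg_vp)
      from comb_scale[OF rel[OF this], of "inverse (poly p (\<alpha> l))"]
      have "below (3 ^ n) (\<lambda>u. u l ^ 3 ^ (n - l))"
      proof (rule comb_cong)
        fix u
        have "(\<Sum>i\<in>J. poly p (\<alpha> i) * u i ^ 3 ^ (n - i)) = (\<Sum>i\<in>J. if i = l then poly p (\<alpha> i) * u i ^ 3 ^ (n - i) else 0)"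
          by (rule sum.cong) (use vp0[of "J - {l}"] in \<open>auto simp: p_def\<close>)
        also have "\<dots> = poly p (\<alpha> l) * u l ^ 3 ^ (n - l)" using l finJ by simp
        finally show "inverse (poly p (\<alpha> l)) * (\<Sum>i\<in>J. poly p (\<alpha> i) * u i ^ 3 ^ (n - i)) = u l ^ 3 ^ (n - l)"
          using vp0[of "J - {l}" l] l by (simp add: p_def)
      qed
      then show ?thesis by (simp add: wl l)
    qed
    then have "card Z' \<le> (\<Prod>l\<in>J. 3 ^ (n - l))"
      by (intro footprint_bound sep) (use fin in \<open>auto simp: Z'_def\<close>)
    also have "\<dots> \<le> (\<Prod>l\<in>J. 3 ^ n * (2 * n * 3 ^ n + 1))"
    proof (intro prod_mono conjI)
      fix l
      have "3 ^ (n - l) * 1 \<le> (3 ^ n * (2 * n * 3 ^ n + 1) :: nat)" by (intro mult_le_mono) auto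
      then show "3 ^ (n - l) \<le> (3 ^ n * (2 * n * 3 ^ n + 1) :: nat)" by simp
    qed simp
    also have "\<dots> = (3 ^ n * (2 * n * 3 ^ n + 1)) ^ card J" by simp
    also have "\<dots> \<le> (3 ^ n * (2 * n * 3 ^ n + 1)) ^ n"
    proof (rule power_increasing)
      show "card J \<le> n" using card_mono[OF _ J] by simp
      show "1 \<le> 3 ^ n * (2 * n * 3 ^ n + 1)" unfolding One_nat_def Suc_le_eq by simp
    qed
    finally show ?thesis .
  next
    fix G u assume card_J: "card J = Suc h" and G: "polynomial_functions.comb J UNIV (exps J 2) G"
      "\<forall>x\<in>Z. G (\<lambda>i. x i - a i) = 0" "G u \<noteq> 0"
    \<comment> \<open>The coefficients of \<open>G\<close> are taken over the whole space: the value
      at \<open>u\<close> then forces a nonzero one, whereas on \<open>Z'\<close> the function is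
      zero.\<close>
    interpret all: ternary_functions J "UNIV :: (nat \<Rightarrow> 'a) set" n
      by unfold_locales (use finJ J in auto)
    obtain cf where cf: "\<And>u. G u = (\<Sum>e\<in>exps J 2. cf e * monom_fun J e u)"
      using all.comb_exps[OF G(1)] by blast
    have "\<exists>e0\<in>exps J 2. cf e0 \<noteq> 0"
    proof (rule ccontr)
      assume "\<not> ?thesis"
      then have "G u = 0" unfolding cf by (intro sum.neutral) auto
      with G(3) show False by simp
    qed
    then obtain e0 where e0: "e0 \<in> exps J 2" "cf e0 \<noteq> 0" by blast
    obtain k where k: "k \<in> J" using card_J by fastforce
    have "\<exists>\<gamma>. \<gamma> \<noteq> 0 \<and> below (3 ^ n) (\<lambda>u. u l ^ 3 ^ (n - l) - \<gamma> * u k ^ 3 ^ (n - k))" if l: "l \<in> J" for l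
    proof (cases "l = k")
      case True
      then show ?thesis by (intro exI[of _ 1]) (simp add: comb_zero)
    next
      case False
      \<comment> \<open>The degree is \<open>card J - 2 = h - 1\<close>, and only the leading terms
        of \<open>l\<close> and \<open>k\<close> survive.\<close>
      define p where "p = vp (J - {l, k})"
      have "card (J - {l, k}) = card J - 2" using l k False finJ by (subst card_Diff_subset) auto
      moreover have "card {l, k} \<le> card J" using l k finJ by (intro card_mono) auto
      ultimately have "degree p < h" using card_J False by (simp add: p_def deg_vp)
      note r = comb_scale[OF rel[OF this], of "inverse (poly p (\<alpha> l))"]
      have pl: "poly p (\<alpha> l) \<noteq> 0" "poly p (\<alpha> k) \<noteq> 0"
        using vp0[of "J - {l, k}" l] vp0[of "J - {l, k}" k] l k by (auto simp: p_def)
      have "below (3 ^ n) (\<lambda>u. u l ^ 3 ^ (n - l) - (- poly p (\<alpha> k) / poly p (\<alpha> l)) * u k ^ 3 ^ (n - k))"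
        using r
      proof (rule comb_cong)
        fix u
        have "(\<Sum>i\<in>J. poly p (\<alpha> i) * u i ^ 3 ^ (n - i)) = (\<Sum>i\<in>{l, k}. poly p (\<alpha> i) * u i ^ 3 ^ (n - i))"
          by (rule sum.mono_neutral_right) (use vp0[of "J - {l, k}"] l k finJ in \<open>auto simp: p_def\<close>)
        also have "\<dots> = poly p (\<alpha> l) * u l ^ 3 ^ (n - l) + poly p (\<alpha> k) * u k ^ 3 ^ (n - k)"
          using False by simp
        finally show "inverse (poly p (\<alpha> l)) * (\<Sum>i\<in>J. poly p (\<alpha> i) * u i ^ 3 ^ (n - i)) =
            u l ^ 3 ^ (n - l) - (- poly p (\<alpha> k) / poly p (\<alpha> l)) * u k ^ 3 ^ (n - k)"
          using pl by (simp add: field_simps)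
      qed
      with pl show ?thesis by (intro exI[of _ "- poly p (\<alpha> k) / poly p (\<alpha> l)"]) simp
    qed
    then have "\<forall>l\<in>J. \<exists>\<gamma>. \<gamma> \<noteq> 0 \<and> below (3 ^ n) (\<lambda>u. u l ^ 3 ^ (n - l) - \<gamma> * u k ^ 3 ^ (n - k))"
      by (rule ballI)
    from bchoice[OF this] obtain \<gamma> where
      "\<forall>l\<in>J. \<gamma> l \<noteq> 0 \<and> below (3 ^ n) (\<lambda>u. u l ^ 3 ^ (n - l) - \<gamma> l * u k ^ 3 ^ (n - k))"
      by (rule exE)
    note \<gamma> = bspec[OF this]
    show ?thesis
    proof (rule card_curve_quadric_le[where k = k and c = cf, OF _ sep k \<gamma> _ e0])
      show "finite Z'" using fin by (simp add: Z'_def)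
      fix u assume "u \<in> Z'"
      then show "(\<Sum>e\<in>exps J 2. cf e * monom_fun J e u) = 0"
        using G(2) by (auto simp: Z'_def \<psi>_def cf[symmetric])
    qed
  qed
  then show ?thesis by (simp add: card_Z')
qed

end

section \<open>Complete bipartite subgraphs of quadric graphs\<close>

lemma sum_lessThan_double:
  fixes g :: "nat \<Rightarrow> 'a::comm_monoid_add"
  shows "(\<Sum>i<2 * k. g i) = (\<Sum>i<k. g (2 * i) + g (2 * i + 1))"
  by (induction k) (simp_all add: ac_simps)

locale quadric_graph = char3_subfield S for S :: "'a::field set" +
  fixes m \<epsilon> :: nat and \<nu> :: 'a and \<alpha> :: "nat \<Rightarrow> 'a"
  assumes m: "m \<ge> 1" and \<epsilon>: "\<epsilon> \<le> 1"
    and \<nu>_S [simp]: "\<nu> \<in> S" and nonsquare: "\<And>x. x \<in> S \<Longrightarrow> x\<^sup>2 \<noteq> \<nu>"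
    and \<alpha>_inj: "inj_on \<alpha> {..<2 * m + \<epsilon>}" and \<alpha>_S [simp]: "\<And>i. \<alpha> i \<in> S"
begin

definition n where "n = 2 * m + \<epsilon>"

text \<open>The coordinates \<open>2 * i\<close> and \<open>2 * i + 1\<close> span a hyperbolic
  plane. The factor \<open>of_nat \<epsilon>\<close> switches the extra square on in odd dimension,
  so that one formula serves both parities.\<close>

definition Q :: "(nat \<Rightarrow> 'a) \<Rightarrow> 'a" where
  "Q x = (\<Sum>i<m. x (2 * i) * x (2 * i + 1)) + of_nat \<epsilon> * (x (2 * m))\<^sup>2"

definition polar :: "(nat \<Rightarrow> 'a) \<Rightarrow> (nat \<Rightarrow> 'a) \<Rightarrow> 'a" where
  "polar x y = (\<Sum>i<m. x (2 * i) * y (2 * i + 1) + x (2 * i + 1) * y (2 * i)) + of_nat \<epsilon> * (2 * x (2 * m) * y (2 * m))"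

text \<open>The Gram matrix of \<open>polar\<close> applied to \<open>y\<close>. It turns
  orthogonality for \<open>polar\<close> into orthogonality for the ordinary scalar product.\<close>

definition dual :: "(nat \<Rightarrow> 'a) \<Rightarrow> nat \<Rightarrow> 'a" where
  "dual y i = (if i < 2 * m then if even i then y (i + 1) else y (i - 1)
     else if i = 2 * m \<and> \<epsilon> = 1 then 2 * y (2 * m) else 0)"

lemma Q_add: "Q (\<lambda>i. x i + y i) = Q x + Q y + polar x y"
  by (simp add: Q_def polar_def algebra_simps sum.distrib power2_eq_square)

lemma Q_scale: "Q (\<lambda>i. c * x i) = c\<^sup>2 * Q x"
  by (simp add: Q_def algebra_simps sum_distrib_left power2_eq_square)

lemma Q_diff_commute: "Q (\<lambda>i. x i - y i) = Q (\<lambda>i. y i - x i)"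
  using Q_scale[of "-1" "\<lambda>i. x i - y i"] by simp

lemma polar_add_right: "polar x (\<lambda>i. y i + z i) = polar x y + polar x z"
  and polar_add_left: "polar (\<lambda>i. y i + z i) x = polar y x + polar z x"
  by (simp_all add: polar_def algebra_simps sum.distrib)

lemma polar_scale_right: "polar x (\<lambda>i. c * y i) = c * polar x y"
  and polar_scale_left: "polar (\<lambda>i. c * y i) x = c * polar y x"
  by (simp_all add: polar_def algebra_simps sum_distrib_left)

lemma polar_diff_right: "polar x (\<lambda>i. y i - z i) = polar x y - polar x z"
  using polar_add_right[of x y "\<lambda>i. -1 * z i"] polar_scale_right[of x "-1" z] by simp

lemma polar_commute: "polar x y = polar y x"
  by (simp add: polar_def algebra_simps)

lemma polar_dual: "polar x y = (\<Sum>i<n. x i * dual y i)"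
proof -
  have "(\<Sum>i<2 * m. x i * dual y i) = (\<Sum>i<m. x (2 * i) * y (2 * i + 1) + x (2 * i + 1) * y (2 * i))"
    unfolding sum_lessThan_double by (rule sum.cong) (auto simp: dual_def)
  moreover have "(\<Sum>i<n. x i * dual y i) = (\<Sum>i<2 * m. x i * dual y i) + of_nat \<epsilon> * (2 * x (2 * m) * y (2 * m))"
  proof -
    have "\<epsilon> = 0 \<or> \<epsilon> = 1" using \<epsilon> by auto
    then show ?thesis unfolding n_def dual_def by (elim disjE) (simp_all add: algebra_simps)
  qed
  ultimately show ?thesis by (simp add: polar_def)
qed

lemma two_neq_0: "(2::'a) \<noteq> 0"
  by (simp add: two)

lemma dual_vecs: "y \<in> vecs n \<Longrightarrow> dual y \<in> vecs n"
proof -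
  assume "y \<in> vecs n"
  moreover have "2 \<in> S" by (simp add: two)
  ultimately show ?thesis using \<epsilon> by (auto simp: vecs_def dual_def n_def)
qed

lemma inj_dual: "inj_on dual (vecs n)"
proof (rule inj_onI, rule ext)
  fix y z i assume yz: "y \<in> vecs n" "z \<in> vecs n" "dual y = dual z"
  have "i < 2 * m \<or> i = 2 * m \<and> \<epsilon> = 1 \<or> i \<ge> n"
    using \<epsilon> unfolding n_def by linarith
  then consider "i < 2 * m" "even i" | "i < 2 * m" "odd i" | "i = 2 * m" "\<epsilon> = 1" | "i \<ge> n"
    by blast
  then show "y i = z i"
  proof cases
    case 1
    then have "Suc i < 2 * m" by presburger
    then show ?thesis using fun_cong[OF yz(3), of "Suc i"] 1 by (simp add: dual_def)
  next
    case 2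
    then obtain k where "i = Suc k" "even k" by (cases i) auto
    then show ?thesis using fun_cong[OF yz(3), of k] 2 by (simp add: dual_def)
  next
    case 3
    then show ?thesis using fun_cong[OF yz(3), of i] two_neq_0 unfolding dual_def by simp
  next
    case 4
    then show ?thesis using yz by (simp add: vecs_def)
  qed
qed

section \<open>Spheres restricted to flats\<close>

lemma comb_affine:
  fixes b :: 'a and f :: "nat \<Rightarrow> 'a"
  assumes "finite J"
  shows "polynomial_functions.comb J UNIV (exps J 1) (\<lambda>u. b + (\<Sum>j\<in>J. u j * f j))"
proof -
  interpret polynomial_functions J "UNIV :: (nat \<Rightarrow> 'a) set" "\<lambda>_. 0" by unfold_locales (rule assms)
  have "comb (exps J 1) (\<lambda>u. b + (\<Sum>j\<in>J. f j * u j ^ 1))"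
  proof (intro comb_add comb_sum)
    show "comb (exps J 1) (\<lambda>_. b)" by (rule comb_const) (simp add: exps_def)
    fix j assume "j \<in> J"
    then show "comb (exps J 1) (\<lambda>u. f j * u j ^ 1)"
      by (intro comb_scale comb_power_var) (auto simp: exps_def)
  qed
  then show ?thesis by (simp add: mult.commute)
qed

lemma comb_Q:
  assumes "finite J"
  shows "polynomial_functions.comb J UNIV (exps J 2) (\<lambda>u. Q (\<lambda>i. b i + (\<Sum>j\<in>J. u j * e j i)) - c)"
proof -
  interpret polynomial_functions J "UNIV :: (nat \<Rightarrow> 'a) set" "\<lambda>_. 0" by unfold_locales (rule assms)
  have prod: "comb (exps J 2) (\<lambda>u. (b i + (\<Sum>j\<in>J. u j * e j i)) * (b i' + (\<Sum>j\<in>J. u j * e j i')))" for i i'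
  proof (rule comb_mult[OF comb_affine[OF assms] comb_affine[OF assms]])
    fix d d' assume "d \<in> exps J 1" "d' \<in> exps J 1"
    then show "(\<lambda>j. d j + d' j) \<in> exps J 2"
      unfolding exps_def mem_Collect_eq by (metis add.right_neutral add_mono one_add_one)
  qed
  show ?thesis
    unfolding Q_def power2_eq_square
    by (intro comb_diff comb_add comb_sum comb_scale prod comb_const) (simp add: exps_def)
qed

text \<open>Otherwise the form \<open>Q - \<nu> t^2\<close> would vanish on the span of
  \<open>U\<close> and \<open>(d, 1)\<close>, which has dimension \<open>m + 1\<close>. Outside the
  hyperbolic planes this form is anisotropic because \<open>\<nu>\<close> is a nonsquare, so
  \<open>card_isotropic_le\<close> allows dimension at most \<open>m\<close>.\<close>

lemma not_constant_on_flat: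
  assumes ech: "echelon J e U" and U: "subsp U" "U \<subseteq> vecs n" and J: "J \<subseteq> {..<n}" "card J = m"
    and d: "d \<in> vecs n"
  shows "\<exists>x\<in>U. Q (\<lambda>i. d i + x i) \<noteq> \<nu>"
proof (rule ccontr)
  assume "\<not> ?thesis"
  then have const: "Q (\<lambda>i. d i + x i) = \<nu>" if "x \<in> U" for x using that by blast
  have Qd: "Q d = \<nu>" using const[OF subspD(1)[OF U(1)]] by simp
  \<comment> \<open>Comparing \<open>x\<close> with its negative separates the quadratic from the
    linear part.\<close>
  have QU: "Q x = 0" if x: "x \<in> U" for x
  proof -
    have "(\<lambda>i. -1 * x i) \<in> U" by (rule subspD(3)[OF U(1) _ x]) simp
    from const[OF this] const[OF x] have "Q x + polar d x = 0" "Q x - polar d x = 0"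
      unfolding Q_add polar_scale_right Q_scale Qd by (simp_all add: add.assoc)
    then have "2 * Q x = 0" by (metis add.right_neutral add_diff_cancel_left' diff_add_cancel mult_2 add_0)
    then show ?thesis using two_neq_0 by simp
  qed
  have Qy: "Q (\<lambda>i. x i + t * d i) = \<nu> * t\<^sup>2" if x: "x \<in> U" "t \<in> S" for x t
  proof (cases "t = 0")
    case True
    then show ?thesis using QU x by simp
  next
    case False
    have "(\<lambda>i. inverse t * x i) \<in> U" by (rule subspD(3)[OF U(1) _ x(1)]) (use x in simp)
    from const[OF this] have "t\<^sup>2 * Q (\<lambda>i. d i + inverse t * x i) = \<nu> * t\<^sup>2" by simp
    then show ?thesis
      unfolding Q_scale[symmetric] using False by (simp add: distrib_left add.commute flip: mult.assoc)
  qed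
  \<comment> \<open>Coordinate \<open>n\<close>, which is zero on \<open>vecs n\<close>, carries the
    homogenizing variable \<open>t\<close>.\<close>
  define y where "y = (\<lambda>(x, t) i. if i = n then t else x i + t * d i :: 'a)"
  define Y where "Y = y ` (U \<times> S)"
  have y_n: "y (x, t) n = t" for x t by (simp add: y_def)
  have y_i: "y (x, t) i = x i + t * d i" if "i \<noteq> n" for x t i using that by (simp add: y_def)
  have zero: "x i = 0" if "x \<in> vecs n" "i \<ge> n" for x i using that by (simp add: vecs_def)
  have "inj_on y (U \<times> S)"
  proof (rule inj_onI, clarify, rule conjI)
    fix x t x' t' assume *: "x \<in> U" "t \<in> S" "x' \<in> U" "t' \<in> S" "y (x, t) = y (x', t')"
    show t: "t = t'" using fun_cong[OF *(5), of n] by (simp add: y_n)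
    have "x \<in> vecs n" "x' \<in> vecs n" using * U(2) by auto
    then have "x i = x' i" for i
      using fun_cong[OF *(5), of i] t zero[of x i] zero[of x' i] by (cases "i = n") (auto simp: y_i)
    then show "x = x'" by blast
  qed
  then have "card Y = card U * card S" by (simp add: Y_def card_image card_cartesian_product)
  also have "\<dots> = card S ^ Suc m"
    using echelon_card[OF U(1) ech] J finite_subset[OF J(1)] by simp
  finally have card_Y: "card Y = card S ^ Suc m" .
  have Y_vecs: "Y \<subseteq> vecs (Suc n)"
  proof
    fix v assume "v \<in> Y"
    then obtain x t where v: "x \<in> U" "t \<in> S" "v = y (x, t)" by (auto simp: Y_def)
    then have "x \<in> vecs n" using U(2) by blast
    with v d show "v \<in> vecs (Suc n)" by (auto simp: vecs_def y_def)
  qed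
  have "card Y \<le> card S ^ m"
  proof (rule card_isotropic_le[where R = "\<lambda>u. of_nat \<epsilon> * (u (2 * m))\<^sup>2 - \<nu> * (u n)\<^sup>2" and N = "Suc n" and m = m])
    show "of_nat \<epsilon> * (u (2 * m))\<^sup>2 - \<nu> * (u n)\<^sup>2 = of_nat \<epsilon> * (u' (2 * m))\<^sup>2 - \<nu> * (u' n)\<^sup>2"
      if "\<And>i. i \<ge> 2 * m \<Longrightarrow> u i = u' i" for u u' :: "nat \<Rightarrow> 'a"
      using that[of "2 * m"] that[of n] by (simp add: n_def)
    show "u i = 0" if u: "u \<in> vecs (Suc n)" "of_nat \<epsilon> * (u (2 * m))\<^sup>2 - \<nu> * (u n)\<^sup>2 = 0" and i: "i \<ge> 2 * m" for u i
    proof -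
      have \<nu>0: "\<nu> \<noteq> 0" using nonsquare[of 0] by auto
      have uS: "u j \<in> S" for j using u(1) by (simp add: vecs_def)
      have un: "u n = 0"
      proof (rule ccontr)
        assume un: "u n \<noteq> 0"
        show False
        proof (cases "\<epsilon> = 0")
          case True
          then show False using u(2) un \<nu>0 by simp
        next
          case False
          then have "\<epsilon> = 1" using \<epsilon> by simp
          then have "(u (2 * m) / u n)\<^sup>2 = \<nu>" using u(2) un by (simp add: power_divide)
          moreover have "u (2 * m) / u n \<in> S" using uS by simp
          ultimately show False using nonsquare by blast
        qed
      qed
      show "u i = 0"
      proof (cases "i < n")
        case True
        then have "\<epsilon> = 1" "i = 2 * m" using i \<epsilon> by (auto simp: n_def)
        then show ?thesis using u(2) un by simp
      next
        case False
        then show ?thesis using un u(1) by (cases "i = n") (auto simp: vecs_def)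
      qed
    qed
    show "subsp Y"
      unfolding subsp_def
    proof (intro conjI ballI allI)
      show "(\<lambda>_. 0) \<in> Y"
        unfolding Y_def by (rule image_eqI[of _ _ "(\<lambda>_. 0, 0)"]) (use subspD(1)[OF U(1)] in \<open>auto simp: y_def\<close>)
    next
      fix v w assume "v \<in> Y" "w \<in> Y"
      then obtain x t x' t' where v: "x \<in> U" "t \<in> S" "v = y (x, t)" "x' \<in> U" "t' \<in> S" "w = y (x', t')"
        by (auto simp: Y_def)
      show "(\<lambda>i. v i + w i) \<in> Y"
        unfolding Y_def
        by (rule image_eqI[of _ _ "(\<lambda>i. x i + x' i, t + t')"])
          (use v subspD(2)[OF U(1) v(1,4)] in \<open>auto simp: y_def fun_eq_iff algebra_simps\<close>)
    next
      fix c v assume "c \<in> S" "v \<in> Y"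
      then obtain x t where v: "x \<in> U" "t \<in> S" "v = y (x, t)" by (auto simp: Y_def)
      show "(\<lambda>i. c * v i) \<in> Y"
        unfolding Y_def
        by (rule image_eqI[of _ _ "(\<lambda>i. c * x i, c * t)"])
          (use v subspD(3)[OF U(1) \<open>c \<in> S\<close> v(1)] \<open>c \<in> S\<close> in \<open>auto simp: y_def fun_eq_iff algebra_simps\<close>)
    next
      fix v i assume "v \<in> Y"
      then show "v i \<in> S" using Y_vecs by (auto simp: vecs_def)
    qed
    show "Y \<subseteq> vecs (Suc n)" by (rule Y_vecs)
    show "(\<Sum>i<m. v (2 * i) * v (2 * i + 1)) + (of_nat \<epsilon> * (v (2 * m))\<^sup>2 - \<nu> * (v n)\<^sup>2) = 0" if "v \<in> Y" for v
    proof -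
      obtain x t where v: "x \<in> U" "t \<in> S" "v = y (x, t)" using \<open>v \<in> Y\<close> by (auto simp: Y_def)
      have low: "v i = x i + t * d i" if "i < n" for i using that by (simp add: v(3) y_i)
      have "(\<Sum>i<m. v (2 * i) * v (2 * i + 1)) + of_nat \<epsilon> * (v (2 * m))\<^sup>2 = Q (\<lambda>i. x i + t * d i)"
      proof -
        have "(\<Sum>i<m. v (2 * i) * v (2 * i + 1)) =
            (\<Sum>i<m. (x (2 * i) + t * d (2 * i)) * (x (2 * i + 1) + t * d (2 * i + 1)))"
          by (intro sum.cong refl) (subst (1 2) low, auto simp: n_def)
        moreover have "of_nat \<epsilon> * (v (2 * m))\<^sup>2 = of_nat \<epsilon> * (x (2 * m) + t * d (2 * m))\<^sup>2"
          by (cases "\<epsilon> = 0") (simp_all add: low n_def)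
        ultimately show ?thesis by (simp add: Q_def)
      qed
      also have "\<dots> = \<nu> * t\<^sup>2" by (rule Qy[OF v(1,2)])
      finally have "(\<Sum>i<m. v (2 * i) * v (2 * i + 1)) + of_nat \<epsilon> * (v (2 * m))\<^sup>2 = \<nu> * (v n)\<^sup>2"
        by (simp add: v(3) y_n)
      then show ?thesis by (simp add: add_diff_eq)
    qed
  qed auto
  with card_Y card_S_ge_2 show False by simp
qed

section \<open>Sets on the variety that form a complete bipartite graph\<close>

definition bound :: nat where
  "bound = (3 ^ n * (2 * n * 3 ^ n + 1)) ^ n"

text \<open>The equations are indexed by polynomials instead of by exponents
  \<open>t < m - 1\<close>, so that a \<open>p\<close> with prescribed roots can be inserted
  directly.\<close>

definition on_variety :: "('a poly \<Rightarrow> 'a) \<Rightarrow> (nat \<Rightarrow> 'a) set \<Rightarrow> bool" where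
  "on_variety c A \<longleftrightarrow> (\<forall>x\<in>A. \<forall>p. degree p < m - 1 \<longrightarrow> (\<Sum>i<n. poly p (\<alpha> i) * x i ^ 3 ^ (n - i)) = c p)"

text \<open>Below dimension \<open>m\<close> the equations of the variety suffice. In dimension
  \<open>m\<close> the sphere around \<open>b0\<close> provides the quadratic relation, which is
  nontrivial on the flat by \<open>not_constant_on_flat\<close>.\<close>

lemma card_flat_sphere_le:
  assumes ech: "echelon J e U" and U: "subsp U" "U \<subseteq> vecs n" and J: "J \<subseteq> {..<n}" "card J \<le> m"
    and A: "A \<subseteq> vecs n" "on_variety c A" "\<And>a. a \<in> A \<Longrightarrow> (\<lambda>i. a i - a0 i) \<in> U"
    and b: "a0 \<in> vecs n" "b0 \<in> vecs n" "\<And>a. a \<in> A \<Longrightarrow> Q (\<lambda>i. a i - b0 i) = \<nu>"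
  shows "card A \<le> bound"
proof -
  have finJ: "finite J" using finite_subset[OF J(1)] by simp
  have "card J \<le> m - 1 \<or> card J = Suc (m - 1) \<and> (\<exists>G u. polynomial_functions.comb J UNIV (exps J 2) G \<and>
      (\<forall>x\<in>A. G (\<lambda>i. x i - a0 i) = 0) \<and> G u \<noteq> 0)"
  proof (cases "card J = m")
    case True
    define d where "d = (\<lambda>i. a0 i - b0 i)"
    have "d \<in> vecs n" unfolding d_def by (rule vecs_diff[OF b(1,2)])
    from not_constant_on_flat[OF ech U J(1) True this]
    obtain x where x: "x \<in> U" "Q (\<lambda>i. d i + x i) \<noteq> \<nu>" by blast
    define G where "G u = Q (\<lambda>i. d i + (\<Sum>j\<in>J. u j * e j i)) - \<nu>" for u
    have GU: "G u = Q (\<lambda>i. d i + u i) - \<nu>" if "u \<in> U" for u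
    proof -
      have "(\<Sum>j\<in>J. u j * e j i) = u i" for i using echelonD(4)[OF ech that, of i] by (rule sym)
      then show ?thesis by (simp add: G_def)
    qed
    have "polynomial_functions.comb J UNIV (exps J 2) G"
      unfolding G_def by (rule comb_Q[OF finJ])
    moreover have "G (\<lambda>i. x i - a0 i) = 0" if "x \<in> A" for x
      unfolding GU[OF A(3)[OF that]] using b(3)[OF that] by (simp add: d_def)
    moreover have "G x \<noteq> 0" unfolding GU[OF x(1)] using x(2) by simp
    moreover have "card J = Suc (m - 1)" using True m by simp
    ultimately show ?thesis by blast
  qed (use J(2) in auto)
  then show ?thesis
    unfolding bound_def
  proof (rule card_evasive_le[OF ech J(1), rotated 4])
    show "inj_on \<alpha> {..<n}" using \<alpha>_inj by (simp add: n_def)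
    show "finite A" using A(1) finite_vecs by (rule finite_subset)
    show "(\<Sum>i<n. poly p (\<alpha> i) * x i ^ 3 ^ (n - i)) = c p" if "x \<in> A" "degree p < m - 1" for x p
      using A(2) that unfolding on_variety_def by blast
  qed (rule A(3))
qed

text \<open>By polarization the differences within \<open>A\<close> are orthogonal to those within
  \<open>B\<close>. They lie in \<open>UA\<close> and its orthogonal space \<open>UB\<close>, whose
  dimensions add up to at most \<open>n \<le> 2 * m + 1\<close>, so one of them is at most
  \<open>m\<close>. The corresponding set lies on a flat and on a sphere around a point of the other
  set.\<close>

lemma complete_bipartite_le:
  assumes A: "A \<subseteq> vecs n" "on_variety cA A" and B: "B \<subseteq> vecs n" "on_variety cB B"
    and AB: "\<And>a b. a \<in> A \<Longrightarrow> b \<in> B \<Longrightarrow> Q (\<lambda>i. a i - b i) = \<nu>"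
  shows "card A \<le> bound \<or> card B \<le> bound"
proof (cases "A = {} \<or> B = {}")
  case False
  then obtain a0 b0 where ab0: "a0 \<in> A" "b0 \<in> B" by blast
  define UA where "UA = {x \<in> vecs n. \<forall>b\<in>B. polar x (\<lambda>i. b i - b0 i) = 0}"
  define UB where "UB = {y \<in> vecs n. \<forall>x\<in>UA. polar x y = 0}"
  have UA: "subsp UA" "UA \<subseteq> vecs n"
    by (auto simp: subsp_def UA_def vecs_def polar_add_left polar_scale_left) (simp add: polar_def)
  have UB: "subsp UB" "UB \<subseteq> vecs n"
    by (auto simp: subsp_def UB_def vecs_def polar_add_right polar_scale_right) (simp add: polar_def)
  have A_UA: "(\<lambda>i. a i - a0 i) \<in> UA" if a: "a \<in> A" for a
  proof -
    have "polar (\<lambda>i. a i - a0 i) (\<lambda>i. b i - b0 i) = 0" if b: "b \<in> B" for b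
    proof -
      have *: "Q (\<lambda>i. x i - y i) = Q x + Q y - polar x y" for x y
        using Q_add[of x "\<lambda>i. -1 * y i"] Q_scale[of "-1" y] polar_scale_right[of x "-1" y] by simp
      have "polar (\<lambda>i. a i - a0 i) (\<lambda>i. b i - b0 i) = polar a b - polar a b0 - (polar a0 b - polar a0 b0)"
        by (simp add: polar_diff_right polar_commute[of "\<lambda>i. a i - a0 i"] polar_commute[of _ a] polar_commute[of _ a0])
      moreover have "polar a b = Q a + Q b - \<nu>" "polar a b0 = Q a + Q b0 - \<nu>"
        "polar a0 b = Q a0 + Q b - \<nu>" "polar a0 b0 = Q a0 + Q b0 - \<nu>"
        using AB[OF a b] AB[OF a ab0(2)] AB[OF ab0(1) b] AB[OF ab0] unfolding * by (auto simp: algebra_simps)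
      ultimately show ?thesis by simp
    qed
    moreover have "(\<lambda>i. a i - a0 i) \<in> vecs n" using a ab0 A(1) by (intro vecs_diff) auto
    ultimately show ?thesis by (simp add: UA_def)
  qed
  have B_UB: "(\<lambda>i. b i - b0 i) \<in> UB" if b: "b \<in> B" for b
  proof -
    have "(\<lambda>i. b i - b0 i) \<in> vecs n" using b ab0 B(1) by (intro vecs_diff) auto
    then show ?thesis using b by (simp add: UB_def UA_def)
  qed
  obtain JA eA where JA: "JA \<subseteq> {..<n}" "echelon JA eA UA" using echelon_exists[OF UA] .
  obtain JB eB where JB: "JB \<subseteq> {..<n}" "echelon JB eB UB" using echelon_exists[OF UB] .
  have "card S ^ card JB = card UB"
    using echelon_card[OF UB(1) JB(2)] finite_subset[OF JB(1)] by simp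
  also have "\<dots> = card (dual ` UB)" using inj_on_subset[OF inj_dual UB(2)] by (simp add: card_image)
  also have "\<dots> \<le> card S ^ (n - card JA)"
    by (rule card_annihilator_le[OF JA(2,1)]) (use UB(2) dual_vecs in \<open>auto simp: UB_def simp flip: polar_dual\<close>)
  finally have "card JB \<le> n - card JA" using card_S_ge_2 power_le_imp_le_exp by fastforce
  moreover have "card JA \<le> n" using card_mono[OF _ JA(1)] by simp
  ultimately have "card JA \<le> m \<or> card JB \<le> m" using \<epsilon> by (auto simp: n_def)
  then show ?thesis
  proof
    assume "card JA \<le> m"
    then have "card A \<le> bound"
    proof (rule card_flat_sphere_le[OF JA(2) UA JA(1) _ A A_UA])
      show "Q (\<lambda>i. a i - b0 i) = \<nu>" if "a \<in> A" for a using AB[OF that ab0(2)] .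
    qed (use ab0 A B in auto)
    then show ?thesis ..
  next
    assume "card JB \<le> m"
    then have "card B \<le> bound"
    proof (rule card_flat_sphere_le[OF JB(2) UB JB(1) _ B B_UB])
      show "Q (\<lambda>i. b i - a0 i) = \<nu>" if "b \<in> B" for b
        using AB[OF ab0(1) that] by (subst Q_diff_commute)
    qed (use ab0 A B in auto)
    then show ?thesis ..
  qed
qed auto

end

section \<open>Dense fibres\<close>

text \<open>Removing an element of least weight does not lower the average weight. The inequality
  between averages is cleared of denominators.\<close>

lemma heavy_subset:
  fixes w :: "'b \<Rightarrow> nat"
  assumes "finite T" "k \<le> card T"
  shows "\<exists>T'\<subseteq>T. card T' = k \<and> k * sum w T \<le> card T * sum w T'"
  using assms
proof (induction "card T" arbitrary: T rule: less_induct)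
  case less
  show ?case
  proof (cases "k = card T \<or> k = 0")
    case True
    then show ?thesis by (elim disjE) (use less.prems in \<open>auto intro: exI[of _ "{}"]\<close>)
  next
    case False
    then have k: "k < card T" "k > 0" using less.prems by auto
    then have "T \<noteq> {}" by auto
    then have "Min (w ` T) \<in> w ` T" using less.prems by (intro Min_in) auto
    then obtain x where x: "x \<in> T" "w x = Min (w ` T)" by auto
    define T1 where "T1 = T - {x}"
    have card_T: "card T = Suc (card T1)" "finite T1" and sum_T: "sum w T = w x + sum w T1"
      using x(1) less.prems(1) card_Suc_Diff1[of T x] sum.remove[of T x w] by (auto simp: T1_def simp del: card_Diff_insert)
    have "card T1 * w x \<le> sum w T1"
    proof -
      have "(\<Sum>y\<in>T1. w x) \<le> sum w T1"
        using x(2) less.prems(1) by (intro sum_mono) (auto simp: T1_def)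
      then show ?thesis by simp
    qed
    then have 1: "card T1 * sum w T \<le> card T * sum w T1" by (simp add: sum_T card_T algebra_simps)
    obtain T' where T': "T' \<subseteq> T1" "card T' = k" "k * sum w T1 \<le> card T1 * sum w T'"
      using less.hyps[of T1] k card_T by auto
    have "card T1 * (k * sum w T) \<le> k * (card T * sum w T1)" using 1 by (simp add: mult.left_commute)
    also have "\<dots> \<le> card T1 * (card T * sum w T')" using T'(3) by (simp add: mult.left_commute)
    finally have "k * sum w T \<le> card T * sum w T'" using k card_T by simp
    then show ?thesis using T'(1,2) by (auto simp: T1_def)
  qed
qed

context quadric_graph
begin

text \<open>Padding by zero from component \<open>m - 1\<close> on makes the value an element of
  \<open>vecs (m - 1)\<close>, so that the number of fibres can be bounded.\<close>

definition power_sums :: "(nat \<Rightarrow> 'a) \<Rightarrow> nat \<Rightarrow> 'a" where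
  "power_sums x t = (if t < m - 1 then \<Sum>i<n. \<alpha> i ^ t * x i ^ 3 ^ (n - i) else 0)"

lemma power_sums_add: "power_sums (\<lambda>i. x i + y i) = (\<lambda>t. power_sums x t + power_sums y t)"
  by (auto simp: power_sums_def frob algebra_simps sum.distrib)

lemma power_sums_diff: "power_sums (\<lambda>i. x i - y i) = (\<lambda>t. power_sums x t - power_sums y t)"
  by (auto simp: power_sums_def frob_diff algebra_simps sum_subtractf)

lemma power_sums_vecs: "x \<in> vecs n \<Longrightarrow> power_sums x \<in> vecs (m - 1)"
  by (auto simp: power_sums_def vecs_def intro!: sum_S)

definition fibre :: "(nat \<Rightarrow> 'a) \<Rightarrow> (nat \<Rightarrow> 'a) set" where
  "fibre y = {x \<in> vecs n. power_sums x = y}"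

lemma fibre_vecs: "fibre y \<subseteq> vecs n"
  by (auto simp: fibre_def)

text \<open>The equation for \<open>p\<close> is the combination of the component equations with the
  coefficients of \<open>p\<close>.\<close>

lemma fibre_on_variety: "on_variety (\<lambda>p. \<Sum>t<m - 1. coeff p t * y t) (fibre y)"
  unfolding on_variety_def
proof (intro ballI allI impI)
  fix x and p :: "'a poly" assume x: "x \<in> fibre y" and p: "degree p < m - 1"
  have "poly p a = (\<Sum>t<m - 1. coeff p t * a ^ t)" for a
    unfolding poly_altdef using p by (intro sum.mono_neutral_left) (auto simp: coeff_eq_0 not_le)
  then have "(\<Sum>i<n. poly p (\<alpha> i) * x i ^ 3 ^ (n - i)) =
      (\<Sum>i<n. \<Sum>t<m - 1. coeff p t * (\<alpha> i ^ t * x i ^ 3 ^ (n - i)))"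
    by (simp add: sum_distrib_right mult.assoc)
  also have "\<dots> = (\<Sum>t<m - 1. coeff p t * power_sums x t)"
    by (subst sum.swap) (simp add: power_sums_def sum_distrib_left)
  finally show "(\<Sum>i<n. poly p (\<alpha> i) * x i ^ 3 ^ (n - i)) = (\<Sum>t<m - 1. coeff p t * y t)"
    using x by (simp add: fibre_def)
qed

text \<open>The map is additive, so a nonempty fibre is a translate of the kernel.\<close>

lemma card_fibre:
  assumes "x0 \<in> vecs n"
  shows "card (fibre (power_sums x0)) = card (fibre (\<lambda>_. 0))"
proof (rule bij_betw_same_card[of "\<lambda>x i. x i - x0 i"], rule bij_betw_byWitness[where f' = "\<lambda>x i. x i + x0 i"])
  show "(\<lambda>x i. x i - x0 i) ` fibre (power_sums x0) \<subseteq> fibre (\<lambda>_. 0)"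
    using vecs_diff[OF _ assms] by (auto simp: fibre_def power_sums_diff)
  show "(\<lambda>x i. x i + x0 i) ` fibre (\<lambda>_. 0) \<subseteq> fibre (power_sums x0)"
    using vecs_add[OF _ assms] by (auto simp: fibre_def power_sums_add)
qed auto

lemma card_fibres: "card (power_sums ` vecs n) * card (fibre (\<lambda>_. 0)) = card S ^ n"
proof -
  have "card S ^ n = card (\<Union>y\<in>power_sums ` vecs n. fibre y)"
    unfolding card_vecs[symmetric] by (rule arg_cong[where f = card]) (auto simp: fibre_def)
  also have "\<dots> = (\<Sum>y\<in>power_sums ` vecs n. card (fibre y))"
    by (rule card_UN_disjoint) (auto simp: fibre_def intro: finite_subset[OF _ finite_vecs])
  also have "\<dots> = (\<Sum>y\<in>power_sums ` vecs n. card (fibre (\<lambda>_. 0)))"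
    by (rule sum.cong) (auto simp: card_fibre)
  finally show ?thesis by simp
qed

text \<open>At most \<open>card S ^ (m - 1)\<close> fibres of equal size share all vectors, and
  \<open>n - (m - 1) = m + \<epsilon> + 1\<close>.\<close>

lemma card_fibre_ge: "card S ^ (m + \<epsilon> + 1) \<le> card (fibre (\<lambda>_. 0))"
proof -
  have "card (power_sums ` vecs n) \<le> card (vecs (m - 1))"
    by (rule card_mono) (use power_sums_vecs in auto)
  then have "card (power_sums ` vecs n) * card (fibre (\<lambda>_. 0)) \<le> card S ^ (m - 1) * card (fibre (\<lambda>_. 0))"
    unfolding card_vecs by (rule mult_le_mono1)
  moreover have "n = (m - 1) + (m + \<epsilon> + 1)" using m by (simp add: n_def)
  then have "card S ^ n = card S ^ (m - 1) * card S ^ (m + \<epsilon> + 1)" by (metis power_add)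
  ultimately have "card S ^ (m - 1) * card S ^ (m + \<epsilon> + 1) \<le> card S ^ (m - 1) * card (fibre (\<lambda>_. 0))"
    unfolding card_fibres by simp
  then show ?thesis using card_S_ge_2 by simp
qed

text \<open>Coordinate 0 is chosen nonzero and the coordinates from 2 on are arbitrary; coordinate 1
  is then solved for. The function \<open>sh\<close> puts the free part behind two zeros.\<close>

lemma card_sphere_ge: "(card S - 1) * card S ^ (n - 2) \<le> card {v \<in> vecs n. Q v = \<nu>}"
proof -
  define sh where "sh w i = (if i < 2 then 0 else w (i - 2))" for w :: "nat \<Rightarrow> 'a" and i
  define v where "v = (\<lambda>(c, w) i. if i = 0 then c else if i = 1 then (\<nu> - Q (sh w)) / c else sh w i)"
  have n2: "n \<ge> 2" using m by (simp add: n_def)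
  have split: "Q u = u 0 * u 1 + ((\<Sum>i\<in>{1..<m}. u (2 * i) * u (2 * i + 1)) + of_nat \<epsilon> * (u (2 * m))\<^sup>2)" for u
    unfolding Q_def using m by (simp add: lessThan_atLeast0 sum.atLeast_Suc_lessThan add.assoc)
  have v: "v (c, w) \<in> {v \<in> vecs n. Q v = \<nu>}" if c: "c \<in> S - {0}" and w: "w \<in> vecs (n - 2)" for c w
  proof -
    have sh: "sh w i \<in> S" for i using w by (simp add: sh_def vecs_def)
    have sh0: "sh w i = 0" if "i \<ge> n" for i using w that n2 by (simp add: sh_def vecs_def)
    have "Q (sh w) \<in> S"
      unfolding Q_def using \<epsilon> by (cases "\<epsilon> = 0") (auto simp: sh le_Suc_eq intro!: add_S sum_S)
    then have "v (c, w) \<in> vecs n" using c sh sh0 n2 by (auto simp: vecs_def v_def)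
    moreover have "Q (v (c, w)) = c * ((\<nu> - Q (sh w)) / c) + ((\<Sum>i\<in>{1..<m}. sh w (2 * i) * sh w (2 * i + 1)) + of_nat \<epsilon> * (sh w (2 * m))\<^sup>2)"
      unfolding split[of "v (c, w)"] using m by (auto simp: v_def)
    moreover have "Q (sh w) = (\<Sum>i\<in>{1..<m}. sh w (2 * i) * sh w (2 * i + 1)) + of_nat \<epsilon> * (sh w (2 * m))\<^sup>2"
      unfolding split[of "sh w"] by (simp add: sh_def)
    ultimately show ?thesis using c by simp
  qed
  have "inj_on v ((S - {0}) \<times> vecs (n - 2))"
  proof (rule inj_onI)
    fix p p' assume "v p = v p'"
    moreover obtain c w c' w' where p: "p = (c, w)" "p' = (c', w')" by (cases p, cases p')
    ultimately have eq: "v (c, w) = v (c', w')" by simp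
    have "c = c'" using fun_cong[OF eq, of 0] by (simp add: v_def)
    moreover have "w i = w' i" for i using fun_cong[OF eq, of "i + 2"] by (simp add: v_def sh_def)
    then have "w = w'" by blast
    ultimately show "p = p'" using p by simp
  qed
  then have "card ((S - {0}) \<times> vecs (n - 2)) \<le> card {v \<in> vecs n. Q v = \<nu>}"
    by (rule card_inj_on_le) (use v in auto)
  then show ?thesis by (simp add: card_cartesian_product card_vecs card_Diff_singleton)
qed

text \<open>Averaging the sphere over the fibres, which have equal size: with
  \<open>q = card S\<close>, some fibre has a proportion of at least \<open>(q - 1) / q^2\<close> of
  its points on the sphere.\<close>

lemma dense_fibre:
  obtains y where "y \<in> power_sums ` vecs n"
    "(card S - 1) * card (fibre (\<lambda>_. 0)) \<le> card {v \<in> fibre y. Q v = \<nu>} * card S ^ 2"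
proof -
  define I where "I = power_sums ` vecs n"
  define k where "k y = card {v \<in> fibre y. Q v = \<nu>}" for y
  have I: "finite I" "I \<noteq> {}" using card_vecs[of n] card_S_ge_2 by (auto simp: I_def)
  have "card {v \<in> vecs n. Q v = \<nu>} = card (\<Union>y\<in>I. {v \<in> fibre y. Q v = \<nu>})"
    by (rule arg_cong[where f = card]) (auto simp: fibre_def I_def)
  also have "\<dots> = (\<Sum>y\<in>I. k y)"
    unfolding k_def using I(1) by (intro card_UN_disjoint) (auto simp: fibre_def)
  finally have sum: "card {v \<in> vecs n. Q v = \<nu>} = (\<Sum>y\<in>I. k y)" .
  have "Max (k ` I) \<in> k ` I" using I by (intro Max_in) auto
  then obtain y where y: "y \<in> I" "k y = Max (k ` I)" by auto
  have "(\<Sum>y\<in>I. k y) \<le> (\<Sum>_\<in>I. k y)" using y I by (intro sum_mono) auto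
  then have "(card S - 1) * card S ^ (n - 2) \<le> card I * k y" using card_sphere_ge sum by simp
  then have "(card S - 1) * card S ^ (n - 2) * card (fibre (\<lambda>_. 0)) \<le> card I * k y * card (fibre (\<lambda>_. 0))"
    by (rule mult_le_mono1)
  also have "\<dots> = card S ^ (n - 2) * (k y * card S ^ 2)"
  proof -
    have "n = n - 2 + 2" using m by (simp add: n_def)
    then have "card S ^ n = card S ^ (n - 2) * card S ^ 2" by (metis power_add)
    then show ?thesis using card_fibres by (simp add: I_def mult_ac)
  qed
  finally have "card S ^ (n - 2) * ((card S - 1) * card (fibre (\<lambda>_. 0))) \<le> card S ^ (n - 2) * (k y * card S ^ 2)"
    by (simp add: mult_ac)
  then have "(card S - 1) * card (fibre (\<lambda>_. 0)) \<le> k y * card S ^ 2" using card_S_ge_2 by simp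
  with y that[of y] show ?thesis by (simp add: I_def k_def)
qed

text \<open>About half of the points come from the kernel, the others from a dense fibre. Since all
  of \<open>P\<close> lies in two fibres, \<open>2 * bound + 1\<close> points include more than
  \<open>bound\<close> from a single fibre, and \<open>complete_bipartite_le\<close> applies to such
  parts.\<close>

lemma point_set_exists:
  assumes N: "1 \<le> N" "N \<le> card S ^ (m + \<epsilon> + 1)"
  obtains P where "P \<subseteq> vecs n" "card P = N"
    "\<forall>A\<subseteq>P. \<forall>B\<subseteq>P. card A = 2 * bound + 1 \<longrightarrow> card B = 2 * bound + 1 \<longrightarrow>
      (\<exists>a\<in>A. \<exists>b\<in>B. Q (\<lambda>i. a i - b i) \<noteq> \<nu>)"
    "(card S - 1) * ((N div 2) * (N - N div 2)) \<le>
      card S ^ 2 * card {(a, b). a \<in> P \<and> b \<in> P \<and> Q (\<lambda>i. a i - b i) = \<nu>}"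
proof -
  define q where "q = card S"
  obtain y where y: "y \<in> power_sums ` vecs n"
    and dense: "(card S - 1) * card (fibre (\<lambda>_. 0)) \<le> card {v \<in> fibre y. Q v = \<nu>} * card S ^ 2"
    by (rule dense_fibre)
  define P0 where "P0 = fibre (\<lambda>_. 0)"
  define P1 where "P1 = fibre y"
  define k where "k = card {v \<in> P1. Q v = \<nu>}"
  have fin: "finite P0" "finite P1" unfolding P0_def P1_def by (rule finite_subset[OF fibre_vecs finite_vecs])+
  have card_P1: "card P1 = card P0" using y card_fibre by (auto simp: P0_def P1_def)
  have N_P0: "N \<le> card P0" using N(2) card_fibre_ge by (simp add: P0_def)
  \<comment> \<open>Translation by the kernel element \<open>a\<close> maps the fibre
    \<open>P1\<close> to itself, so all points of \<open>P0\<close> have equally many neighbours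
    there.\<close>
  have regular: "card {b \<in> P1. Q (\<lambda>i. a i - b i) = \<nu>} = k" if a: "a \<in> P0" for a
  proof -
    have "bij_betw (\<lambda>b i. b i - a i) {b \<in> P1. Q (\<lambda>i. a i - b i) = \<nu>} {v \<in> P1. Q v = \<nu>}"
    proof (rule bij_betw_byWitness[where f' = "\<lambda>v i. v i + a i"])
      show "(\<lambda>b i. b i - a i) ` {b \<in> P1. Q (\<lambda>i. a i - b i) = \<nu>} \<subseteq> {v \<in> P1. Q v = \<nu>}"
        using a by (auto simp: P0_def P1_def fibre_def power_sums_diff vecs_diff Q_diff_commute[of a])
      show "(\<lambda>v i. v i + a i) ` {v \<in> P1. Q v = \<nu>} \<subseteq> {b \<in> P1. Q (\<lambda>i. a i - b i) = \<nu>}"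
        using a by (auto simp: P0_def P1_def fibre_def power_sums_add vecs_add Q_diff_commute[of a])
    qed auto
    then show ?thesis unfolding k_def by (rule bij_betw_same_card)
  qed
  have "N div 2 \<le> card P0" using N_P0 by linarith
  then obtain A' where A': "A' \<subseteq> P0" "card A' = N div 2" by (rule obtain_subset_with_card_n)
  define w where "w b = card {a \<in> A'. Q (\<lambda>i. a i - b i) = \<nu>}" for b
  have finA': "finite A'" by (rule finite_subset[OF A'(1) fin(1)])
  have sum_w: "sum w T = card {(a, b). a \<in> A' \<and> b \<in> T \<and> Q (\<lambda>i. a i - b i) = \<nu>}" if "finite T" for T
  proof -
    have "sum w T = card (SIGMA b:T. {a \<in> A'. Q (\<lambda>i. a i - b i) = \<nu>})"
      unfolding w_def using that finA' by (intro card_SigmaI[symmetric]) auto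
    also have "\<dots> = card {(a, b). a \<in> A' \<and> b \<in> T \<and> Q (\<lambda>i. a i - b i) = \<nu>}"
      by (rule bij_betw_same_card[of prod.swap], rule bij_betw_byWitness[where f' = prod.swap]) auto
    finally show ?thesis .
  qed
  have "sum w P1 = card (SIGMA a:A'. {b \<in> P1. Q (\<lambda>i. a i - b i) = \<nu>})"
    unfolding sum_w[OF fin(2)] by (rule arg_cong[where f = card]) auto
  also have "\<dots> = (\<Sum>a\<in>A'. card {b \<in> P1. Q (\<lambda>i. a i - b i) = \<nu>})"
    using finA' fin(2) by (intro card_SigmaI) auto
  also have "\<dots> = (\<Sum>a\<in>A'. k)"
    by (rule sum.cong) (use A'(1) regular in auto)
  finally have sum_P1: "sum w P1 = N div 2 * k" using A'(2) by simp
  have "N - N div 2 \<le> card P1" using N_P0 card_P1 by simp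
  from heavy_subset[OF fin(2) this, of w]
  obtain B' where B': "B' \<subseteq> P1" "card B' = N - N div 2"
    "(N - N div 2) * sum w P1 \<le> card P1 * sum w B'" by blast
  \<comment> \<open>For \<open>y = 0\<close> both fibres coincide and the halves may overlap;
    further points of the fibres fill the set up to exactly \<open>N\<close>.\<close>
  have "card (A' \<union> B') \<le> N" using card_Un_le[of A' B'] A'(2) B'(2) by simp
  moreover have "N \<le> card (P0 \<union> P1)" using N_P0 card_mono[of "P0 \<union> P1" P0] fin by simp
  ultimately obtain P where P: "A' \<union> B' \<subseteq> P" "P \<subseteq> P0 \<union> P1" "card P = N"
    using exists_subset_between[of "A' \<union> B'" N "P0 \<union> P1"] A'(1) B'(1) fin by blast
  have finP: "finite P" using finite_subset[OF P(2)] fin by simp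
  have free: "\<exists>a\<in>A. \<exists>b\<in>B. Q (\<lambda>i. a i - b i) \<noteq> \<nu>"
    if AB: "A \<subseteq> P" "B \<subseteq> P" "card A = 2 * bound + 1" "card B = 2 * bound + 1" for A B
  proof -
    have large: "\<exists>R c. R \<subseteq> X' \<and> R \<subseteq> vecs n \<and> on_variety c R \<and> bound < card R"
      if X': "X' \<subseteq> P" "card X' = 2 * bound + 1" for X'
    proof -
      have "X' = (X' \<inter> P0) \<union> (X' \<inter> P1)" using X' P(2) by blast
      then have "card X' \<le> card (X' \<inter> P0) + card (X' \<inter> P1)" by (metis card_Un_le)
      then have "bound < card (X' \<inter> P0) \<or> bound < card (X' \<inter> P1)" using X'(2) by linarith
      moreover have "on_variety (\<lambda>p. \<Sum>t<m - 1. coeff p t * y' t) (X' \<inter> fibre y')" for y'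
        using fibre_on_variety[of y'] by (auto simp: on_variety_def)
      ultimately show ?thesis using fibre_vecs unfolding P0_def P1_def by (meson Int_lower1 Int_lower2 order_trans)
    qed
    obtain RA cA where RA: "RA \<subseteq> A" "RA \<subseteq> vecs n" "on_variety cA RA" "bound < card RA"
      using large[OF AB(1,3)] by blast
    obtain RB cB where RB: "RB \<subseteq> B" "RB \<subseteq> vecs n" "on_variety cB RB" "bound < card RB"
      using large[OF AB(2,4)] by blast
    show "\<exists>a\<in>A. \<exists>b\<in>B. Q (\<lambda>i. a i - b i) \<noteq> \<nu>"
    proof (rule ccontr)
      assume "\<not> ?thesis"
      then have "card RA \<le> bound \<or> card RB \<le> bound"
        using RA(1) RB(1) by (intro complete_bipartite_le[OF RA(2,3) RB(2,3)]) blast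
      then show False using RA(4) RB(4) by linarith
    qed
  qed
  show thesis
  proof
    show "P \<subseteq> vecs n" using P(2) fibre_vecs by (auto simp: P0_def P1_def)
    show "card P = N" by (rule P(3))
    show "\<forall>A\<subseteq>P. \<forall>B\<subseteq>P. card A = 2 * bound + 1 \<longrightarrow> card B = 2 * bound + 1 \<longrightarrow>
        (\<exists>a\<in>A. \<exists>b\<in>B. Q (\<lambda>i. a i - b i) \<noteq> \<nu>)"
      using free by blast
  next
    define E where "E = card {(a, b). a \<in> P \<and> b \<in> P \<and> Q (\<lambda>i. a i - b i) = \<nu>}"
    have "finite B'" by (rule finite_subset[OF B'(1) fin(2)])
    then have "sum w B' \<le> E"
      unfolding sum_w[OF \<open>finite B'\<close>] E_def
      by (intro card_mono finite_subset[OF _ finite_cartesian_product[OF finP finP]]) (use P(1) in auto)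
    then have "(N - N div 2) * (N div 2 * k) \<le> card P0 * E"
      using B'(3) unfolding sum_P1 card_P1 by (meson le_trans mult_le_mono2)
    then have pairs: "(N - N div 2) * (N div 2 * k) * q\<^sup>2 \<le> card P0 * E * q\<^sup>2" by (rule mult_le_mono1)
    have "card P0 * ((q - 1) * (N div 2 * (N - N div 2))) = N div 2 * (N - N div 2) * ((q - 1) * card P0)"
      by (simp only: mult_ac)
    also have "\<dots> \<le> N div 2 * (N - N div 2) * (k * q\<^sup>2)"
      using dense by (intro mult_le_mono2) (simp add: P0_def P1_def k_def q_def)
    also have "\<dots> = (N - N div 2) * (N div 2 * k) * q\<^sup>2" by (simp only: mult_ac)
    also note pairs
    also have "card P0 * E * q\<^sup>2 = card P0 * (q\<^sup>2 * E)" by (simp only: mult_ac)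
    finally have "card P0 * ((q - 1) * (N div 2 * (N - N div 2))) \<le> card P0 * (q\<^sup>2 * E)" .
    moreover have "card P0 > 0" using N N_P0 by simp
    ultimately show "(card S - 1) * ((N div 2) * (N - N div 2)) \<le> card S ^ 2 * E" by (simp add: q_def)
  qed
qed

end

section \<open>Finite fields of characteristic 3\<close>

context finite_subfield
begin

section \<open>Finite subfields as ring structures on integers\<close>

definition subfield_ring :: "'a ring" where
  "subfield_ring = \<lparr>carrier = S, monoid.mult = (*), one = 1, ring.zero = 0, add = (+)\<rparr>"

lemma subfield_ring_simps [simp]:
  "carrier subfield_ring = S" "monoid.mult subfield_ring = (*)" "one subfield_ring = 1"
  "ring.zero subfield_ring = 0" "add subfield_ring = (+)"
  by (simp_all add: subfield_ring_def)

lemma field_subfield_ring: "field subfield_ring"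
proof -
  have "cring subfield_ring"
  proof (intro cringI abelian_groupI comm_monoidI)
    show "\<exists>y\<in>carrier subfield_ring. y \<oplus>\<^bsub>subfield_ring\<^esub> x = \<zero>\<^bsub>subfield_ring\<^esub>"
      if "x \<in> carrier subfield_ring" for x
      using that by (intro bexI[of _ "- x"]) auto
  qed (auto simp: algebra_simps)
  then show ?thesis
  proof (rule cring.cring_fieldI2)
    fix a assume "a \<in> carrier subfield_ring" "a \<noteq> \<zero>\<^bsub>subfield_ring\<^esub>"
    then show "\<exists>b\<in>carrier subfield_ring. a \<otimes>\<^bsub>subfield_ring\<^esub> b = \<one>\<^bsub>subfield_ring\<^esub>"
      by (intro bexI[of _ "inverse a"]) auto
  qed simp
qed

lemma finsum_subfield_ring:
  assumes "finite I" "\<And>i. i \<in> I \<Longrightarrow> g i \<in> S"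
  shows "finsum subfield_ring g I = sum g I"
proof -
  interpret field subfield_ring by (rule field_subfield_ring)
  show ?thesis using assms by (induction I rule: finite_induct) (auto simp: Pi_def)
qed

text \<open>An injection of the finite set \<open>S\<close> into the integers transports the
  operations. The last conclusion translates \<open>unit_distance\<close> in the copy into sums in
  the original type, where all other computations take place.\<close>

lemma int_copy:
  obtains F :: "int ring" and \<phi> where "field F" "finite (carrier F)" "inj_on \<phi> S" "\<phi> ` S = carrier F"
    "\<And>d u v. (\<And>i. u i \<in> S) \<Longrightarrow> (\<And>i. v i \<in> S) \<Longrightarrow>
      unit_distance F d (\<lambda>i\<in>{1..d}. \<phi> (u i)) (\<lambda>i\<in>{1..d}. \<phi> (v i)) \<longleftrightarrow> (\<Sum>i\<in>{1..d}. (u i - v i)\<^sup>2) = 1"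
proof -
  obtain g :: "'a \<Rightarrow> nat" where "inj_on g S" using finite_imp_inj_to_nat_seg[OF finite_S] by blast
  then have inj: "inj_on (\<lambda>x. int (g x)) S" by (auto simp: inj_on_def)
  define \<phi> where "\<phi> = (\<lambda>x. int (g x))"
  define \<psi> where "\<psi> = inv_into S \<phi>"
  have inj: "inj_on \<phi> S" using inj by (simp add: \<phi>_def)
  then have \<psi>: "\<psi> (\<phi> x) = x" if "x \<in> S" for x using that by (simp add: \<psi>_def inv_into_f_f)
  define F where "F = \<lparr>carrier = \<phi> ` S, monoid.mult = (\<lambda>x y. \<phi> (\<psi> x * \<psi> y)), one = \<phi> 1, ring.zero = \<phi> 0,
    add = (\<lambda>x y. \<phi> (\<psi> x + \<psi> y))\<rparr>"
  have iso: "\<phi> \<in> ring_iso subfield_ring F"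
    unfolding ring_iso_def using inj \<psi> by (auto intro!: ring_hom_memI simp: F_def bij_betw_def)
  interpret R: field subfield_ring by (rule field_subfield_ring)
  have "field (F \<lparr>ring.zero := \<phi> \<zero>\<^bsub>subfield_ring\<^esub>\<rparr>)" by (rule R.ring_iso_imp_img_field[OF iso])
  then have F: "field F" by (simp add: F_def)
  interpret F: field F by (rule F)
  interpret hom: ring_hom_cring subfield_ring F \<phi>
    by unfold_locales (use iso in \<open>simp add: ring_iso_def\<close>)
  have pow: "x [^]\<^bsub>F\<^esub> (2::nat) = x \<otimes>\<^bsub>F\<^esub> x" if "x \<in> carrier F" for x
    using that by (simp add: numeral_2_eq_2)
  have ud: "unit_distance F d (\<lambda>i\<in>{1..d}. \<phi> (u i)) (\<lambda>i\<in>{1..d}. \<phi> (v i)) \<longleftrightarrow> (\<Sum>i\<in>{1..d}. (u i - v i)\<^sup>2) = 1"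
    if uv: "\<And>i. u i \<in> S" "\<And>i. v i \<in> S" for d u v
  proof -
    have diff: "(u i - v i)\<^sup>2 \<in> S" for i using uv by simp
    have minus: "\<phi> x \<ominus>\<^bsub>F\<^esub> \<phi> y = \<phi> (x - y)" if "x \<in> S" "y \<in> S" for x y
    proof -
      have "\<ominus>\<^bsub>subfield_ring\<^esub> y = - y" using that by (intro R.minus_equality) auto
      then have "\<phi> (- y) = \<ominus>\<^bsub>F\<^esub> \<phi> y" using hom.hom_a_inv[of y] that by simp
      then show ?thesis using hom.hom_add[of x "- y"] that by (simp add: a_minus_def)
    qed
    have "(\<Oplus>\<^bsub>F\<^esub>i\<in>{1..d}. ((\<lambda>i\<in>{1..d}. \<phi> (u i)) i \<ominus>\<^bsub>F\<^esub> (\<lambda>i\<in>{1..d}. \<phi> (v i)) i) [^]\<^bsub>F\<^esub> (2::nat)) =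
        (\<Oplus>\<^bsub>F\<^esub>i\<in>{1..d}. (\<phi> \<circ> (\<lambda>i. (u i - v i)\<^sup>2)) i)"
    proof (rule F.finsum_cong')
      fix i assume i: "i \<in> {1..d}"
      have "\<phi> (u i - v i) \<in> carrier F" using uv hom.hom_closed by simp
      then show "((\<lambda>i\<in>{1..d}. \<phi> (u i)) i \<ominus>\<^bsub>F\<^esub> (\<lambda>i\<in>{1..d}. \<phi> (v i)) i) [^]\<^bsub>F\<^esub> (2::nat) =
          (\<phi> \<circ> (\<lambda>i. (u i - v i)\<^sup>2)) i"
        using i uv hom.hom_mult[of "u i - v i" "u i - v i"] by (simp add: minus pow power2_eq_square)
    qed (use diff hom.hom_closed in auto)
    also have "\<dots> = \<phi> (\<Sum>i\<in>{1..d}. (u i - v i)\<^sup>2)"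
      using hom.hom_finsum[of "\<lambda>i. (u i - v i)\<^sup>2" "{1..d}"] diff by (simp add: finsum_subfield_ring)
    finally have "unit_distance F d (\<lambda>i\<in>{1..d}. \<phi> (u i)) (\<lambda>i\<in>{1..d}. \<phi> (v i)) \<longleftrightarrow>
        \<phi> (\<Sum>i\<in>{1..d}. (u i - v i)\<^sup>2) = \<phi> 1"
      unfolding unit_distance_def by (simp add: F_def)
    also have "\<dots> \<longleftrightarrow> (\<Sum>i\<in>{1..d}. (u i - v i)\<^sup>2) = 1"
      using diff by (intro inj_on_eq_iff[OF inj] sum_S) auto
    finally show ?thesis .
  qed
  show thesis by (rule that[OF F _ inj _ ud]) (auto simp: F_def)
qed

text \<open>Squaring identifies 1 and -1, so on the finite set \<open>S\<close> it is not injective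
  and therefore not surjective.\<close>

lemma nonsquare_exists:
  assumes "(1::'a) \<noteq> - 1"
  obtains \<nu> where "\<nu> \<in> S" "\<And>x. x \<in> S \<Longrightarrow> x\<^sup>2 \<noteq> \<nu>"
proof (rule ccontr)
  assume "\<not> thesis"
  then have "S \<subseteq> (\<lambda>x. x\<^sup>2) ` S" using that by blast
  moreover have "(\<lambda>x. x\<^sup>2) ` S \<subseteq> S" by auto
  ultimately have "inj_on (\<lambda>x. x\<^sup>2) S" by (intro eq_card_imp_inj_on) (auto simp: subset_antisym)
  then show False using assms inj_onD[of "\<lambda>x. x\<^sup>2" S 1 "-1"] by simp
qed

end

text \<open>An unordered edge arises from at most two ordered pairs.\<close>

lemma card_pairs_le_edges:
  assumes "finite P" and R: "\<And>a b. a \<in> P \<Longrightarrow> b \<in> P \<Longrightarrow> R a b \<Longrightarrow> {a, b} \<in> E" and E: "E \<subseteq> Pow P"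
  shows "card {(a, b). a \<in> P \<and> b \<in> P \<and> R a b} \<le> 2 * card (E :: 'b set set)"
proof -
  have finE: "finite E" using E by (rule finite_subset) (simp add: assms(1))
  define W where "W e = {(x, y). {x, y} = e}" for e :: "'b set"
  have W: "finite (W e) \<and> card (W e) \<le> 2" for e
  proof (cases "\<exists>a b. e = {a, b}")
    case True
    then obtain a b where "e = {a, b}" by blast
    then have sub: "W e \<subseteq> {(a, b), (b, a)}" by (auto simp: W_def doubleton_eq_iff)
    then have "card (W e) \<le> card {(a, b), (b, a)}" by (rule card_mono[rotated]) simp
    also have "\<dots> \<le> 2" using card_length[of "[(a, b), (b, a)]"] by simp
    finally show ?thesis using finite_subset[OF sub] by simp
  next
    case False
    then have "W e = {}" by (auto simp: W_def)
    then show ?thesis by simp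
  qed
  have "card {(a, b). a \<in> P \<and> b \<in> P \<and> R a b} \<le> card (\<Union>e\<in>E. W e)"
    by (rule card_mono) (use finE W R in \<open>auto simp: W_def\<close>)
  also have "\<dots> \<le> (\<Sum>e\<in>E. card (W e))" by (rule card_UN_le[OF finE])
  also have "\<dots> \<le> (\<Sum>e\<in>E. 2)" by (intro sum_mono) (use W in blast)
  finally show ?thesis by simp
qed

section \<open>The field with three elements and its finite extensions\<close>

datatype gf3 = Zero3 | One3 | Two3

instantiation gf3 :: field
begin

definition "0 = Zero3"
definition "1 = One3"

fun plus_gf3 where
  "Zero3 + x = (x :: gf3)"
| "x + Zero3 = x"
| "One3 + One3 = Two3"
| "One3 + Two3 = Zero3"
| "Two3 + One3 = Zero3"
| "Two3 + Two3 = One3"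

fun times_gf3 where
  "Zero3 * x = (Zero3 :: gf3)"
| "One3 * x = x"
| "Two3 * Zero3 = Zero3"
| "Two3 * One3 = Two3"
| "Two3 * Two3 = One3"

fun uminus_gf3 where
  "- Zero3 = Zero3"
| "- One3 = Two3"
| "- Two3 = One3"

text \<open>Both nonzero elements are their own inverses, and zero is sent to zero by
  convention.\<close>

definition "inverse x = (x :: gf3)"
definition "x - y = x + - (y :: gf3)"
definition "x div y = x * (y :: gf3)"

instance
proof
  fix a b c :: gf3
  show "a + b + c = a + (b + c)" by (cases a; cases b; cases c) simp_all
  show "a * b * c = a * (b * c)" by (cases a; cases b; cases c) simp_all
  show "a + b = b + a" "a * b = b * a" by (cases a; cases b; simp)+
  show "0 + a = a" "1 * a = a" "- a + a = 0" by (cases a; simp add: zero_gf3_def one_gf3_def)+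
  show "(a + b) * c = a * c + b * c" by (cases a; cases b; cases c) simp_all
  show "(0::gf3) \<noteq> 1" by (simp add: zero_gf3_def one_gf3_def)
  show "a \<noteq> 0 \<Longrightarrow> inverse a * a = 1" by (cases a) (simp_all add: zero_gf3_def one_gf3_def inverse_gf3_def)
qed (auto simp: minus_gf3_def divide_gf3_def inverse_gf3_def zero_gf3_def)

end

lemma three_alg_closure_gf3: "(3 :: gf3 alg_closure) = 0"
proof -
  have "(3::gf3) = 0" by (simp add: zero_gf3_def one_gf3_def numeral_3_eq_3[symmetric] numeral.simps)
  then have "to_ac (3::gf3) = 0" by simp
  then show ?thesis by (simp only: to_ac_numeral)
qed

text \<open>The finite field as fixed set of a Frobenius power, so that all extensions lie in one
  type. For \<open>r = 0\<close> the equation is trivial, whence the condition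
  \<open>r \<ge> 1\<close> in the counting lemmas.\<close>

definition gf :: "nat \<Rightarrow> gf3 alg_closure set" where
  "gf r = {x. x ^ 3 ^ r = x}"

lemma gf_frob: "((x::gf3 alg_closure) + y) ^ 3 ^ k = x ^ 3 ^ k + y ^ 3 ^ k"
  by (rule frobenius_add[OF three_alg_closure_gf3])

text \<open>The polynomial \<open>X^q - X\<close> splits over the algebraic closure, and its
  derivative is the constant -1, so it has \<open>q\<close> distinct roots.\<close>

lemma finite_gf: "r \<ge> 1 \<Longrightarrow> finite (gf r)"
  and card_gf: "r \<ge> 1 \<Longrightarrow> card (gf r) = 3 ^ r"
proof -
  assume r: "r \<ge> 1"
  define q :: nat where "q = 3 ^ r"
  have q: "q > 1" unfolding q_def by (rule one_less_power) (use r in auto)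
  define p :: "gf3 alg_closure poly" where "p = monom 1 q - monom 1 1"
  have deg: "degree p = q"
    unfolding p_def diff_conv_add_uminus
    by (subst degree_add_eq_left) (use q in \<open>simp_all add: degree_monom_eq\<close>)
  then have p0: "p \<noteq> 0" using q by auto
  have root: "poly p x = 0 \<longleftrightarrow> x \<in> gf r" for x
    by (simp add: p_def poly_monom gf_def q_def)
  obtain A where A: "size A = q" "p = smult (lead_coeff p) (\<Prod>x\<in>#A. [:-x, 1:])"
    using alg_closed_imp_factorization[OF p0] deg by auto
  have "of_nat q = (0 :: gf3 alg_closure)"
    unfolding q_def using r by (simp add: three_alg_closure_gf3 power_0_left)
  then have deriv: "poly (pderiv p) x = -1" for x
    by (simp add: p_def pderiv_diff pderiv_monom poly_monom)
  have count: "count A x \<le> 1" for x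
  proof (rule ccontr)
    assume "\<not> ?thesis"
    then have "x \<in># A" "x \<in># A - {#x#}" by (auto simp: not_le simp flip: count_greater_zero_iff)
    then obtain B where B: "A = add_mset x (add_mset x B)" by (metis insert_DiffM)
    define g where "g = smult (lead_coeff p) (\<Prod>x\<in>#B. [:-x, 1:])"
    have "p = [:-x, 1:] * ([:-x, 1:] * g)" by (subst A(2)) (simp add: B g_def mult_ac)
    then have "poly (pderiv p) x = 0" by (simp only: pderiv_mult poly_add poly_mult) simp
    then show False by (simp add: deriv)
  qed
  have set_A: "set_mset A = gf r"
  proof (rule Set.set_eqI)
    fix x
    have "x \<in> gf r \<longleftrightarrow> poly (smult (lead_coeff p) (\<Prod>x\<in>#A. [:-x, 1:])) x = 0"
      using A(2) root by simp
    also have "\<dots> \<longleftrightarrow> x \<in># A"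
      using p0 by (auto simp: poly_prod_mset prod_mset_zero_iff image_iff)
    finally show "x \<in># A \<longleftrightarrow> x \<in> gf r" ..
  qed
  then show "finite (gf r)" by (metis finite_set_mset)
  have "size A = (\<Sum>x\<in>set_mset A. count A x)" by (simp add: size_multiset_overloaded_eq)
  also have "\<dots> = (\<Sum>x\<in>set_mset A. 1)"
  proof (rule sum.cong)
    fix x assume "x \<in># A"
    then have "count A x \<ge> 1" by (simp add: Suc_le_eq)
    with count[of x] show "count A x = 1" by (rule order.antisym)
  qed simp
  finally show "card (gf r) = 3 ^ r" using A(1) set_A by (simp add: q_def)
qed

lemma minus_power_3: "(- (x :: gf3 alg_closure)) ^ 3 ^ r = - (x ^ 3 ^ r)"
  by (rule power_minus_odd) simp

lemma char3_subfield_gf: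
  assumes "r \<ge> 1"
  shows "char3_subfield (gf r)"
proof unfold_locales
  fix x y assume "x \<in> gf r" "y \<in> gf r"
  then have xy: "x ^ 3 ^ r = x" "y ^ 3 ^ r = y" by (simp_all add: gf_def)
  show "x + y \<in> gf r" unfolding gf_def mem_Collect_eq gf_frob xy ..
  show "x * y \<in> gf r" unfolding gf_def mem_Collect_eq power_mult_distrib xy ..
next
  fix x assume "x \<in> gf r"
  then have x: "x ^ 3 ^ r = x" by (simp add: gf_def)
  show "- x \<in> gf r" unfolding gf_def mem_Collect_eq minus_power_3 x ..
  show "inverse x \<in> gf r" unfolding gf_def mem_Collect_eq power_inverse x ..
next
  show "finite (gf r)" by (rule finite_gf[OF assms])
  show "(3 :: gf3 alg_closure) = 0" by (rule three_alg_closure_gf3)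
  show "0 \<in> gf r" "1 \<in> gf r" by (simp_all add: gf_def power_0_left)
qed

lemma gf_mono: "gf r \<subseteq> gf (2 * r)"
proof
  fix x assume "x \<in> gf r"
  then have x: "x ^ 3 ^ r = x" by (simp add: gf_def)
  have "x ^ 3 ^ (2 * r) = (x ^ 3 ^ r) ^ 3 ^ r" by (simp add: mult_2 power_add power_mult)
  also have "\<dots> = x" unfolding x x ..
  finally show "x \<in> gf (2 * r)" by (simp add: gf_def)
qed

text \<open>The Frobenius power fixing \<open>gf r\<close> sends \<open>\<rho>\<close> to
  \<open>\<rho>\<close> or \<open>- \<rho>\<close>, so applying it twice fixes
  \<open>\<rho>\<close>.\<close>

lemma sqrt_gf:
  assumes "\<rho>\<^sup>2 \<in> gf r"
  shows "\<rho> \<in> gf (2 * r)"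
proof -
  have "(\<rho> ^ 3 ^ r)\<^sup>2 = \<rho>\<^sup>2" using assms by (simp add: gf_def mult.commute flip: power_mult)
  then have "\<rho> ^ 3 ^ r = \<rho> \<or> \<rho> ^ 3 ^ r = - \<rho>" by (simp add: power2_eq_iff)
  then have "(\<rho> ^ 3 ^ r) ^ 3 ^ r = \<rho>" by (auto simp: minus_power_3)
  then show ?thesis by (simp add: gf_def mult_2 power_add power_mult)
qed

section \<open>Sums of squares\<close>

context quadric_graph
begin

text \<open>In characteristic 3 one has \<open>x y = (x + y)\<^sup>2 - (x - y)\<^sup>2\<close>, so that over a field with
  \<open>\<rho>\<^sup>2 = \<nu>\<close> and \<open>\<iota>\<^sup>2 = -1\<close> the form \<open>Q / \<nu>\<close> becomes a sum of squares.\<close>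

definition to_squares :: "'a \<Rightarrow> 'a \<Rightarrow> (nat \<Rightarrow> 'a) \<Rightarrow> nat \<Rightarrow> 'a" where
  "to_squares \<rho> \<iota> v i = (if i < 2 * m then if even i then (v i + v (i + 1)) / \<rho> else \<iota> * (v (i - 1) - v i) / \<rho>
     else v i / \<rho>)"

lemma sum_to_squares:
  assumes "\<rho>\<^sup>2 = \<nu>" "\<iota>\<^sup>2 = -1" and u: "u \<in> vecs n" "v \<in> vecs n"
  shows "(\<Sum>i<n. (to_squares \<rho> \<iota> u i - to_squares \<rho> \<iota> v i)\<^sup>2) = Q (\<lambda>i. u i - v i) / \<nu>"
proof -
  define w where "w = (\<lambda>i. u i - v i)"
  define D where "D i = to_squares \<rho> \<iota> u i - to_squares \<rho> \<iota> v i" for i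
  have pair: "(D (2 * i))\<^sup>2 + (D (2 * i + 1))\<^sup>2 = w (2 * i) * w (2 * i + 1) / \<nu>" if "i < m" for i
  proof -
    have 1: "D (2 * i) = (w (2 * i) + w (2 * i + 1)) / \<rho>"
      using that by (simp add: D_def to_squares_def w_def add_divide_distrib diff_divide_distrib)
    have 2: "D (2 * i + 1) = \<iota> * (w (2 * i) - w (2 * i + 1)) / \<rho>"
      using that by (simp add: D_def to_squares_def w_def algebra_simps add_divide_distrib diff_divide_distrib)
    have "(D (2 * i))\<^sup>2 + (D (2 * i + 1))\<^sup>2 = ((w (2 * i) + w (2 * i + 1))\<^sup>2 + \<iota>\<^sup>2 * (w (2 * i) - w (2 * i + 1))\<^sup>2) / \<nu>"
      unfolding 1 2 power_divide assms(1) power_mult_distrib by (rule add_divide_distrib[symmetric])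
    also have "(w (2 * i) + w (2 * i + 1))\<^sup>2 + \<iota>\<^sup>2 * (w (2 * i) - w (2 * i + 1))\<^sup>2 = 3 * (w (2 * i) * w (2 * i + 1)) + w (2 * i) * w (2 * i + 1)"
      unfolding assms(2) by (simp add: power2_eq_square algebra_simps)
    finally show ?thesis by (simp add: three)
  qed
  have "(\<Sum>i<2 * m. (D i)\<^sup>2) = (\<Sum>i<m. w (2 * i) * w (2 * i + 1)) / \<nu>"
    unfolding sum_lessThan_double sum_divide_distrib by (intro sum.cong refl pair) auto
  moreover have "(D (2 * m))\<^sup>2 = (w (2 * m))\<^sup>2 / \<nu>"
    by (simp add: D_def to_squares_def w_def power_divide assms(1) flip: diff_divide_distrib)
  moreover have "(\<Sum>i<n. (D i)\<^sup>2) = (\<Sum>i<2 * m. (D i)\<^sup>2) + of_nat \<epsilon> * (D (2 * m))\<^sup>2"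
  proof -
    have "\<epsilon> = 0 \<or> \<epsilon> = 1" using \<epsilon> by auto
    then show ?thesis unfolding n_def by (elim disjE) simp_all
  qed
  ultimately show ?thesis by (simp add: D_def[symmetric] w_def[symmetric] Q_def add_divide_distrib)
qed

lemma to_squares_inj:
  assumes "\<rho> \<noteq> 0" "\<iota> \<noteq> 0" and uv: "u \<in> vecs n" "v \<in> vecs n"
    and eq: "\<And>i. i < n \<Longrightarrow> to_squares \<rho> \<iota> u i = to_squares \<rho> \<iota> v i"
  shows "u = v"
proof -
  have two_cancel: "x = y" if "2 * x = 2 * y" for x y :: 'a
    using that two_neq_0 by simp
  have pair: "u (2 * i) = v (2 * i) \<and> u (2 * i + 1) = v (2 * i + 1)" if "i < m" for i
  proof -
    have "2 * i < n" "2 * i + 1 < n" using that by (simp_all add: n_def)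
    from eq[OF this(1)] eq[OF this(2)] that assms(1,2)
    have s: "u (2 * i) + u (2 * i + 1) = v (2 * i) + v (2 * i + 1)"
      and d: "u (2 * i) - u (2 * i + 1) = v (2 * i) - v (2 * i + 1)"
      by (simp_all add: to_squares_def)
    have "2 * u (2 * i) = (u (2 * i) + u (2 * i + 1)) + (u (2 * i) - u (2 * i + 1))" by simp
    also have "\<dots> = (v (2 * i) + v (2 * i + 1)) + (v (2 * i) - v (2 * i + 1))" unfolding s d ..
    also have "\<dots> = 2 * v (2 * i)" by simp
    finally have "u (2 * i) = v (2 * i)" by (rule two_cancel)
    with s show ?thesis by simp
  qed
  show ?thesis
  proof
    fix i
    consider "i < 2 * m" | "2 * m \<le> i" "i < n" | "n \<le> i" by linarith
    then show "u i = v i"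
    proof cases
      case 1
      then have "i div 2 < m" by auto
      from pair[OF this] show ?thesis by (cases "even i") (simp_all add: odd_two_times_div_two_succ)
    next
      case 2
      then show ?thesis using eq[of i] assms(1) by (simp add: to_squares_def)
    next
      case 3
      then show ?thesis using uv by (simp add: vecs_def)
    qed
  qed
qed

end

text \<open>The point set is found over \<open>gf r\<close>, and \<open>to_squares\<close> moves it
  to \<open>gf (2 * r)\<close>, which contains square roots of \<open>\<nu>\<close> and of -1;
  \<open>F\<close> is a copy of this larger field. The condition \<open>d \<le> 3 ^ r\<close> leaves
  room for distinct \<open>\<alpha> i\<close>.\<close>

lemma large_graph_exists:
  assumes d: "d \<ge> 2" and r: "r \<ge> 1" "d \<le> 3 ^ r"
    and N: "1 \<le> N" "N \<le> (3 ^ r) ^ (d div 2 + d mod 2 + 1)"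
  shows "\<exists>(F :: int ring) P. field F \<and> finite (carrier F) \<and> P \<subseteq> affine_space F d \<and> card P = N \<and>
    \<not> contains_Kss P (unit_distance_edges F d P) (2 * (3 ^ d * (2 * d * 3 ^ d + 1)) ^ d + 1) \<and>
    (3 ^ r - 1) * ((N div 2) * (N - N div 2)) \<le> (3 ^ r)\<^sup>2 * (2 * card (unit_distance_edges F d P))"
proof -
  interpret S: char3_subfield "gf r" by (rule char3_subfield_gf[OF r(1)])
  interpret K: char3_subfield "gf (2 * r)" by (rule char3_subfield_gf) (use r(1) in simp)
  have "(1 :: gf3 alg_closure) \<noteq> - 1"
  proof
    assume "(1 :: gf3 alg_closure) = - 1"
    then have "(1 :: gf3 alg_closure) + 1 = 1" using S.two by (simp only: one_add_one)
    then show False by (simp only: add_cancel_left_left one_neq_zero)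
  qed
  then obtain \<nu> where \<nu>: "\<nu> \<in> gf r" "\<And>x. x \<in> gf r \<Longrightarrow> x\<^sup>2 \<noteq> \<nu>" using S.nonsquare_exists by blast
  obtain h where h: "bij_betw h {0..<card (gf r)} (gf r)" using ex_bij_betw_nat_finite[OF S.finite_S] by blast
  define \<alpha> where "\<alpha> i = (if i < d then h i else 0)" for i
  have dr: "d \<le> card (gf r)" using r by (simp add: card_gf)
  interpret quadric_graph "gf r" "d div 2" "d mod 2" \<nu> \<alpha>
  proof
    show "\<alpha> i \<in> gf r" for i
      using bij_betwE[OF h] dr by (auto simp: \<alpha>_def)
    show "inj_on \<alpha> {..<2 * (d div 2) + d mod 2}"
      using bij_betw_imp_inj_on[OF h] dr by (auto simp: inj_on_def \<alpha>_def)
  qed (use d \<nu> in auto)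
  have n: "n = d" by (simp add: n_def)
  have cS: "card (gf r) = 3 ^ r" by (rule card_gf[OF r(1)])
  have N': "N \<le> card (gf r) ^ (d div 2 + d mod 2 + 1)" using N(2) by (simp only: cS)
  obtain P where P: "P \<subseteq> S.vecs n" "card P = N"
    and free: "\<forall>A\<subseteq>P. \<forall>B\<subseteq>P. card A = 2 * bound + 1 \<longrightarrow> card B = 2 * bound + 1 \<longrightarrow>
      (\<exists>a\<in>A. \<exists>b\<in>B. Q (\<lambda>i. a i - b i) \<noteq> \<nu>)"
    and edges: "(card (gf r) - 1) * ((N div 2) * (N - N div 2)) \<le>
      (card (gf r))\<^sup>2 * card {(a, b). a \<in> P \<and> b \<in> P \<and> Q (\<lambda>i. a i - b i) = \<nu>}"
    by (rule point_set_exists[OF N(1) N'])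
  note edges = edges[unfolded cS]
  have bound: "bound = (3 ^ d * (2 * d * 3 ^ d + 1)) ^ d" by (simp add: bound_def n)
  obtain \<rho> \<iota> :: "gf3 alg_closure" where \<rho>: "\<rho>\<^sup>2 = \<nu>" and \<iota>: "\<iota>\<^sup>2 = -1"
    using nth_root_exists[of 2 \<nu>] nth_root_exists[of 2 "-1 :: gf3 alg_closure"] by auto
  have \<nu>0: "\<nu> \<noteq> 0" using \<nu>(2)[of 0] by auto
  have \<rho>\<iota>0: "\<rho> \<noteq> 0" "\<iota> \<noteq> 0" using \<rho> \<iota> \<nu>0 by auto
  have \<rho>\<iota>: "\<rho> \<in> gf (2 * r)" "\<iota> \<in> gf (2 * r)" using sqrt_gf \<rho> \<iota> \<nu>(1) by simp_all
  have in_K: "to_squares \<rho> \<iota> v i \<in> gf (2 * r)" if "v \<in> P" for v i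
  proof -
    have "v j \<in> gf r" for j using subsetD[OF P(1) that] by (simp add: S.vecs_def)
    then have "v j \<in> gf (2 * r)" for j using subsetD[OF gf_mono] by blast
    then show ?thesis using \<rho>\<iota> by (simp add: to_squares_def)
  qed
  obtain F :: "int ring" and \<phi> where F: "field F" "finite (carrier F)" "inj_on \<phi> (gf (2 * r))" "\<phi> ` gf (2 * r) = carrier F"
    and ud: "\<And>d u v. (\<And>i. u i \<in> gf (2 * r)) \<Longrightarrow> (\<And>i. v i \<in> gf (2 * r)) \<Longrightarrow>
      unit_distance F d (\<lambda>i\<in>{1..d}. \<phi> (u i)) (\<lambda>i\<in>{1..d}. \<phi> (v i)) \<longleftrightarrow> (\<Sum>i\<in>{1..d}. (u i - v i)\<^sup>2) = 1"
    by (rule K.int_copy) blast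
  \<comment> \<open>Vectors are indexed from 0, points of the affine space from 1.\<close>
  define \<Psi> where "\<Psi> v = (\<lambda>i\<in>{1..d}. \<phi> (to_squares \<rho> \<iota> v (i - 1)))" for v
  have dist: "unit_distance F d (\<Psi> a) (\<Psi> b) \<longleftrightarrow> Q (\<lambda>i. a i - b i) = \<nu>" if "a \<in> P" "b \<in> P" for a b
  proof -
    have "unit_distance F d (\<Psi> a) (\<Psi> b) \<longleftrightarrow> (\<Sum>i\<in>{1..d}. (to_squares \<rho> \<iota> a (i - 1) - to_squares \<rho> \<iota> b (i - 1))\<^sup>2) = 1"
      unfolding \<Psi>_def by (rule ud) (use in_K that in auto)
    also have "(\<Sum>i\<in>{1..d}. (to_squares \<rho> \<iota> a (i - 1) - to_squares \<rho> \<iota> b (i - 1))\<^sup>2) =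
        (\<Sum>i<n. (to_squares \<rho> \<iota> a i - to_squares \<rho> \<iota> b i)\<^sup>2)"
      unfolding n by (rule sum.reindex_bij_witness[of _ Suc "\<lambda>i. i - 1"]) auto
    also have "\<dots> = Q (\<lambda>i. a i - b i) / \<nu>" by (rule sum_to_squares[OF \<rho> \<iota>]) (use that P in auto)
    finally show ?thesis using \<nu>0 by simp
  qed
  have inj: "inj_on \<Psi> P"
  proof (rule inj_onI)
    fix u v assume uv: "u \<in> P" "v \<in> P" "\<Psi> u = \<Psi> v"
    have "to_squares \<rho> \<iota> u i = to_squares \<rho> \<iota> v i" if "i < n" for i
    proof -
      have "\<phi> (to_squares \<rho> \<iota> u i) = \<phi> (to_squares \<rho> \<iota> v i)"
        using fun_cong[OF uv(3), of "Suc i"] that by (simp add: \<Psi>_def n)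
      then show ?thesis using inj_onD[OF F(3)] in_K uv by blast
    qed
    then show "u = v" using \<rho>\<iota>0 uv P(1) by (intro to_squares_inj[of \<rho> \<iota>]) auto
  qed
  have fin: "finite P" by (rule finite_subset[OF P(1) S.finite_vecs])
  define E where "E = unit_distance_edges F d (\<Psi> ` P)"
  have edge: "{\<Psi> a, \<Psi> b} \<in> E \<longleftrightarrow> Q (\<lambda>i. a i - b i) = \<nu>" if "a \<in> P" "b \<in> P" for a b
  proof
    assume "{\<Psi> a, \<Psi> b} \<in> E"
    then obtain x y where xy: "x \<in> P" "y \<in> P" "unit_distance F d (\<Psi> x) (\<Psi> y)" "{\<Psi> a, \<Psi> b} = {\<Psi> x, \<Psi> y}"
      unfolding E_def unit_distance_edges_def by blast
    then have "x = a \<and> y = b \<or> x = b \<and> y = a"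
      using inj_on_eq_iff[OF inj] that by (auto simp: doubleton_eq_iff)
    then show "Q (\<lambda>i. a i - b i) = \<nu>" using dist[OF xy(1,2)] xy(3) Q_diff_commute by auto
  next
    assume "Q (\<lambda>i. a i - b i) = \<nu>"
    then show "{\<Psi> a, \<Psi> b} \<in> E"
      using dist[OF that] that unfolding E_def unit_distance_edges_def by blast
  qed
  have "\<Psi> ` P \<subseteq> affine_space F d"
    unfolding affine_space_def \<Psi>_def F(4)[symmetric] using in_K by auto
  moreover have "card (\<Psi> ` P) = N" using inj P(2) by (simp add: card_image)
  moreover have "\<not> contains_Kss (\<Psi> ` P) E (2 * bound + 1)"
  proof
    assume "contains_Kss (\<Psi> ` P) E (2 * bound + 1)"
    then obtain A B where AB: "A \<subseteq> \<Psi> ` P" "B \<subseteq> \<Psi> ` P" "card A = 2 * bound + 1" "card B = 2 * bound + 1"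
      "\<And>a b. a \<in> A \<Longrightarrow> b \<in> B \<Longrightarrow> {a, b} \<in> E"
      unfolding contains_Kss_def by blast
    obtain A' where A': "A' \<subseteq> P" "A = \<Psi> ` A'" using AB(1) by (meson subset_imageE)
    obtain B' where B': "B' \<subseteq> P" "B = \<Psi> ` B'" using AB(2) by (meson subset_imageE)
    have "card A' = 2 * bound + 1" "card B' = 2 * bound + 1"
      using AB(3,4) A' B' inj by (metis card_image inj_on_subset)+
    then obtain a b where ab: "a \<in> A'" "b \<in> B'" "Q (\<lambda>i. a i - b i) \<noteq> \<nu>"
      using free A'(1) B'(1) by blast
    then have "{\<Psi> a, \<Psi> b} \<in> E" using AB(5) A' B' by blast
    then show False using edge ab A' B' by blast
  qed
  moreover have "(3 ^ r - 1) * ((N div 2) * (N - N div 2)) \<le> (3 ^ r)\<^sup>2 * (2 * card E)"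
  proof -
    \<comment> \<open>The edge set is pulled back along the injective map \<open>\<Psi>\<close>, so
      that the ordered pairs can be counted inside \<open>P\<close>.\<close>
    have "card {(a, b). a \<in> P \<and> b \<in> P \<and> Q (\<lambda>i. a i - b i) = \<nu>} \<le>
        2 * card {e. e \<subseteq> P \<and> \<Psi> ` e \<in> E}"
      by (rule card_pairs_le_edges[OF fin]) (use edge in auto)
    also have "card {e. e \<subseteq> P \<and> \<Psi> ` e \<in> E} \<le> card E"
    proof (rule card_inj_on_le[of "(`) \<Psi>"])
      show "inj_on ((`) \<Psi>) {e. e \<subseteq> P \<and> \<Psi> ` e \<in> E}"
        using inj_on_image_eq_iff[OF inj] by (auto intro!: inj_onI)
      show "finite E"
        by (rule finite_subset[of _ "Pow (\<Psi> ` P)"]) (use fin in \<open>auto simp: E_def unit_distance_edges_def\<close>)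
    qed auto
    finally show ?thesis using edges by (meson le_trans mult_le_mono2)
  qed
  ultimately show ?thesis using F(1,2) unfolding E_def bound by blast
qed

section \<open>Choice of the field size and final estimate\<close>

lemma field_size_exists:
  fixes d N k :: nat
  assumes "d \<ge> 1" "N \<ge> 1" "k \<ge> 1"
  obtains r where "r \<ge> 1" "d \<le> 3 ^ r" "N \<le> (3 ^ r) ^ k" "real (3 ^ r) \<le> 3 ^ d * real N powr (1 / real k)"
proof -
  \<comment> \<open>Requiring \<open>d \<le> r\<close> ensures both \<open>r \<ge> 1\<close> and
    \<open>d \<le> 3 ^ r\<close>.\<close>
  define R where "R r \<longleftrightarrow> d \<le> r \<and> N \<le> (3 ^ r) ^ k" for r
  have less: "x < 3 ^ x" for x :: nat by (induction x) auto
  have "R (max d N)"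
  proof -
    have "N \<le> 3 ^ max d N" using less[of "max d N"] by linarith
    also have "\<dots> \<le> (3 ^ max d N) ^ k" using assms(3) by (simp add: self_le_power)
    finally show ?thesis by (simp add: R_def)
  qed
  then have R: "R (LEAST r. R r)" by (rule LeastI)
  define r where "r = (LEAST r. R r)"
  have r: "d \<le> r" "N \<le> (3 ^ r) ^ k" using R by (auto simp: r_def R_def)
  have N1: "1 \<le> real N powr (1 / real k)" using assms by (intro ge_one_powr_ge_zero) auto
  \<comment> \<open>If the least \<open>r\<close> equals \<open>d\<close>, the factor
    \<open>3 ^ d\<close> covers it. Otherwise its predecessor is too small for \<open>N\<close>, so
    \<open>3 ^ r\<close> exceeds the root of \<open>N\<close> at most by the factor 3.\<close>
  have "real (3 ^ r) \<le> 3 ^ d * real N powr (1 / real k)"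
  proof (cases "r = d")
    case True
    then show ?thesis using N1 by simp
  next
    case False
    then obtain r' where r': "r = Suc r'" "d \<le> r'" using r(1) by (cases r) auto
    then have "\<not> R r'" using not_less_Least[of r' R] by (simp add: r_def[symmetric])
    then have "(3 ^ r') ^ k < N" using r' by (auto simp: R_def)
    then have "real (3 ^ r') ^ k \<le> real N" by (metis less_imp_le of_nat_le_iff of_nat_power)
    moreover have "real (3 ^ r') = (real (3 ^ r') ^ k) powr (1 / real k)"
      using assms(3) by (simp add: powr_powr flip: powr_realpow)
    ultimately have "real (3 ^ r') \<le> real N powr (1 / real k)"
      by (metis powr_mono2 divide_nonneg_nonneg of_nat_0_le_iff zero_le_one zero_le_power)
    moreover have "(3::real) \<le> 3 ^ d" using assms(1) by (simp add: self_le_power)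
    ultimately have "3 * real (3 ^ r') \<le> 3 ^ d * real N powr (1 / real k)" by (intro mult_mono) auto
    then show ?thesis by (simp add: r')
  qed
  moreover have "d \<le> 3 ^ r" using less[of r] r(1) by linarith
  ultimately show thesis using that[of r] r assms(1) by simp
qed

text \<open>Let \<open>k\<close> be the denominator in the exponent. A power \<open>q\<close> of 3
  of order \<open>n powr (1 / k)\<close> with \<open>n \<le> q ^ k\<close> makes the two fibres
  large enough, and a proportion of about \<open>1 / q\<close> of the pairs gives the order
  \<open>n^2 / q\<close> of edges.\<close>

theorem theorem1p7:
  fixes d :: nat
  assumes "d \<ge> 2"
  shows "\<exists>(s::nat) (c::real). c > 0 \<and>
    (\<forall>n::nat. n \<ge> 1 \<longrightarrow>
      (\<exists>(F :: int ring) (P :: (nat \<Rightarrow> int) set).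
         field F \<and> finite (carrier F) \<and>
         P \<subseteq> affine_space F d \<and> card P = n \<and>
         \<not> contains_Kss P (unit_distance_edges F d P) s \<and>
         (n \<ge> 2 \<longrightarrow>
            c * real n powr (2 - 1 / (real_of_int \<lceil>real d / 2\<rceil> + 1))
              \<le> real (card (unit_distance_edges F d P)))))"
proof -
  define k where "k = d div 2 + d mod 2 + 1"
  have "\<lceil>real d / 2\<rceil> = int (d div 2 + d mod 2)"
  proof (rule ceiling_unique)
    have "real d = 2 * real (d div 2) + real (d mod 2)"
      by (metis mult_div_mod_eq of_nat_add of_nat_mult of_nat_numeral)
    moreover have "d mod 2 = 0 \<or> d mod 2 = 1" by auto
    ultimately show "real_of_int (int (d div 2 + d mod 2)) - 1 < real d / 2"
      "real d / 2 \<le> real_of_int (int (d div 2 + d mod 2))" by auto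
  qed
  then have k: "real_of_int \<lceil>real d / 2\<rceil> + 1 = real k" by (simp add: k_def)
  define s where "s = 2 * (3 ^ d * (2 * d * 3 ^ d + 1)) ^ d + (1::nat)"
  \<comment> \<open>The estimates \<open>n / 3\<close> and \<open>n / 2\<close> for the two halves,
    \<open>2 * q / 3\<close> for \<open>q - 1\<close>, and two ordered pairs per edge give at least
    \<open>n^2 / (18 * q)\<close> edges, where \<open>q \<le> 3 ^ d * n powr (1 / k)\<close>. The
    constant 36 leaves a factor 2 to spare.\<close>
  define c :: real where "c = 1 / (36 * 3 ^ d)"
  have "\<exists>(F :: int ring) (P :: (nat \<Rightarrow> int) set).
         field F \<and> finite (carrier F) \<and> P \<subseteq> affine_space F d \<and> card P = n \<and>
         \<not> contains_Kss P (unit_distance_edges F d P) s \<and>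
         (n \<ge> 2 \<longrightarrow> c * real n powr (2 - 1 / real k) \<le> real (card (unit_distance_edges F d P)))"
    if n: "n \<ge> 1" for n
  proof -
    obtain r where r: "r \<ge> 1" "d \<le> 3 ^ r" "n \<le> (3 ^ r) ^ k"
      and rn: "real (3 ^ r) \<le> 3 ^ d * real n powr (1 / real k)"
      using field_size_exists[of d n k] assms n by (auto simp: k_def)
    from large_graph_exists[OF assms r(1,2) n] r(3)
    obtain F :: "int ring" and P where FP: "field F" "finite (carrier F)" "P \<subseteq> affine_space F d" "card P = n"
      "\<not> contains_Kss P (unit_distance_edges F d P) s"
      and edges: "(3 ^ r - 1) * ((n div 2) * (n - n div 2)) \<le> (3 ^ r)\<^sup>2 * (2 * card (unit_distance_edges F d P))"
      unfolding s_def k_def by blast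
    define e where "e = card (unit_distance_edges F d P)"
    have "c * real n powr (2 - 1 / real k) \<le> real e" if n2: "n \<ge> 2"
    proof -
      define q where "q = real (3 ^ r)"
      have "(3::real) ^ 1 \<le> 3 ^ r" using r(1) by (intro power_increasing) auto
      then have q: "q \<ge> 3" by (simp add: q_def)
      have half: "real n / 3 \<le> real (n div 2)" "real n / 2 \<le> real (n - n div 2)"
      proof -
        have "n \<le> 3 * (n div 2)" "n \<le> 2 * (n - n div 2)" using n2 by linarith+
        then have "real n \<le> real (3 * (n div 2))" "real n \<le> real (2 * (n - n div 2))"
          by (simp_all only: of_nat_le_iff)
        then show "real n / 3 \<le> real (n div 2)" "real n / 2 \<le> real (n - n div 2)" by simp_all
      qed
      have "real ((3 ^ r - 1) * ((n div 2) * (n - n div 2))) \<le> real ((3 ^ r)\<^sup>2 * (2 * e))"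
        using edges unfolding e_def of_nat_le_iff .
      then have le: "(q - 1) * (real (n div 2) * real (n - n div 2)) \<le> q\<^sup>2 * (2 * real e)"
        by (simp add: q_def of_nat_diff)
      have "q * (real n ^ 2 / 9) \<le> (q - 1) * (real n / 3 * (real n / 2))"
      proof -
        have "q * (real n ^ 2 / 9) = (2 * q / 3) * (real n ^ 2 / 6)" by simp
        also have "\<dots> \<le> (q - 1) * (real n ^ 2 / 6)" using q by (intro mult_right_mono) auto
        finally show ?thesis by (simp add: power2_eq_square)
      qed
      also have "\<dots> \<le> (q - 1) * (real (n div 2) * real (n - n div 2))"
        using half q by (intro mult_left_mono mult_mono) auto
      also note le
      finally have "q * (real n ^ 2 / 9) \<le> q * (q * (2 * real e))" by (simp add: power2_eq_square mult.assoc)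
      then have qe: "real n ^ 2 / 18 \<le> q * real e" using q by simp
      have "c * real n powr (2 - 1 / real k) * (3 ^ d * real n powr (1 / real k)) = real n ^ 2 / 36"
        using n by (simp add: c_def powr_diff powr_realpow[of "real n" 2, simplified])
      also have "\<dots> \<le> real n ^ 2 / 18" by simp
      also note qe
      also have "q * real e \<le> (3 ^ d * real n powr (1 / real k)) * real e"
        using rn by (intro mult_right_mono) (auto simp: q_def)
      finally have "c * real n powr (2 - 1 / real k) * (3 ^ d * real n powr (1 / real k)) \<le>
          real e * (3 ^ d * real n powr (1 / real k))" by (simp only: mult.commute[of "real e"])
      then show ?thesis by (rule mult_right_le_imp_le) (use n in simp)
    qed
    with FP show ?thesis unfolding e_def by blast
  qed
  moreover have "c > 0" by (simp add: c_def)
  ultimately show ?thesis unfolding k by blast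
qed

end
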